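(* Let $i\ge1$. The lattice walk of a word $w$ in the alphabet $\{i',i,(i+1)',i+1\}$ determines the shape and weight of $\mathrm{rect}(w)$. That is, if two words in this alphabet have the same lattice walk (the same sequence of points $P_0,P_1,\ldots,P_m$), then their rectifications have the same shape and the same weight.
   Context: Words. Letters are $1'<1<2'<2<3'<3<\cdots$. The canonical form of a finite string of letters is obtained by replacing, for every $i$, the leftmost entry in $\{i,i'\}$ (if there is one) by $i$. Two strings are equivalent if they have the same canonical form; a word is an equivalence class of strings, its members are its representatives, and a word is identified with its representative in canonical form. The weight is $\mathrm{wt}(w)=(n_1,n_2,\ldots)$, where $n_i$ is the number of entries of $w$ equal to $i$ or $i'$. The standardization $\mathrm{std}(w)$ of a word of length $m$ is the permutation obtained by replacing its letters by $1,\ldots,m$ from least to greatest, breaking ties between equal unprimed letters from left to right and between equal primed letters from right to left (independent of the representative). Tableaux. A strict partition is a strictly decreasing finite (possibly empty) sequence $\lambda=(\lambda_1>\cdots>\lambda_k)$ of positive integers; its shifted diagram is the set of boxes $(r,c)$ (row $r$ counted from the top, column $c$ from the left) with $1\le r\le k$ and $r\le c\le r+\lambda_r-1$. A shifted skew shape $\lambda/\mu$ is the difference of two such diagrams, $\mu$ contained in $\lambda$; it is straight if $\mu=\varnothing$. A shifted semistandard tableau of shape $\lambda/\mu$ is a filling of the boxes by letters, weakly increasing along rows (left to right) and down columns, with no primed letter repeated in a row and no unprimed letter repeated in a column, whose row reading word (rows read left to right, concatenated from the bottom row to the top row) is in canonical form. $\mathrm{wt}(T)$ and $\mathrm{std}(T)$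 are defined via the reading word. Jeu de taquin. An inner slide on a tableau $T$ of shape $\lambda/\mu$ starts at a box of $\mu$ whose removal from $\mu$ leaves a shifted diagram; the empty box is repeatedly exchanged with whichever of its right and lower neighbours is smaller (comparing entries of $\mathrm{std}(T)$) until it has neither. The result of a slide on $T$ is the unique shifted semistandard tableau with the same weight as $T$ whose standardization is the slid $\mathrm{std}(T)$ (this incorporates the usual rules for changing primes at the main diagonal and in passing to canonical form). $\mathrm{rect}(T)$ is the straight-shape tableau obtained by performing inner slides until none is possible (independent of choices); for a word $w$, $\mathrm{rect}(w)=\mathrm{rect}(T)$ for any shifted semistandard tableau $T$ with reading word $w$ (for example one whose boxes all lie in distinct rows and distinct columns). Lattice walk. For a word $w=w_1\cdots w_m$ in $\{i',i,(i+1)',i+1\}$, treat $i',i,(i+1)',i+1$ as $1',1,2',2$ and define $P_k=(x_k,y_k)\in\mathbb{N}\times\mathbb{N}$ by $P_0=(0,0)$ and $P_k=P_{k-1}+(\text{step of } w_k)$. If $x_{k-1}y_{k-1}=0$ the step is $(1,0)$ for $w_k\in\{1',1\}$ and $(0,1)$ for $w_k\in\{2',2\}$. If $x_{k-1}y_{k-1}\ne0$ the step is $(1,0)$ for $1'$, $(0,-1)$ for $1$, $(-1,0)$ for $2'$, $(0,1)$ for $2$. (Independent of the representative.) *)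

theory Defs
  imports Main
begin

section \<open>Letters and words\<close>

text \<open>\<open>Primed i\<close> is the letter \<open>i'\<close> and \<open>Unprimed i\<close> is the letter \<open>i\<close>.  Only the indices \<open>i \<ge> 1\<close>
  name letters; this is imposed in \<open>is_word\<close> and \<open>ss_tableau\<close>.\<close>

datatype letter = is_primed: Primed (idx: nat) | Unprimed (idx: nat)

instantiation letter :: linorder
begin

definition less_eq_letter :: "letter \<Rightarrow> letter \<Rightarrow> bool" where
  "a \<le> b \<longleftrightarrow> idx a < idx b \<or> idx a = idx b \<and> (is_primed a \<or> \<not> is_primed b)"

definition less_letter :: "letter \<Rightarrow> letter \<Rightarrow> bool" where
  "a < b \<longleftrightarrow> idx a < idx b \<or> idx a = idx b \<and> is_primed a \<and> \<not> is_primed b"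

instance
  by standard (auto simp: less_eq_letter_def less_letter_def intro: letter.expand)

end

definition canonical_form :: "letter list \<Rightarrow> letter list" where
  "canonical_form w =
     map (\<lambda>k. if idx (w ! k) \<in> idx ` set (take k w) then w ! k else Unprimed (idx (w ! k)))
       [0..<length w]"

text \<open>A word is identified with its representative in canonical form.\<close>

definition is_word :: "letter list \<Rightarrow> bool" where
  "is_word w \<longleftrightarrow> (\<forall>a \<in> set w. 1 \<le> idx a) \<and> canonical_form w = w"

definition wt :: "letter list \<Rightarrow> nat \<Rightarrow> nat" where
  "wt w n = length (filter (\<lambda>a. idx a = n) w)"

text \<open>\<open>std_before w j k\<close>: position \<open>j\<close> of \<open>w\<close> is numbered before position \<open>k\<close> by standardization.\<close>

definition std_before :: "letter list \<Rightarrow> nat \<Rightarrow> nat \<Rightarrow> bool" where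
  "std_before w j k \<longleftrightarrow>
     w ! j < w ! k \<or> w ! j = w ! k \<and> (if is_primed (w ! k) then k < j else j < k)"

definition standardization :: "letter list \<Rightarrow> nat list" where
  "standardization w =
     map (\<lambda>k. Suc (card {j. j < length w \<and> std_before w j k})) [0..<length w]"


section \<open>Shifted skew shapes and tableaux\<close>

definition strict_partition :: "nat list \<Rightarrow> bool" where
  "strict_partition l \<longleftrightarrow> sorted_wrt (>) l \<and> (\<forall>n \<in> set l. 0 < n)"

text \<open>Boxes are pairs (row, column), both numbered from 1; the condition \<open>c < r + l ! (r - 1)\<close> is
  \<open>c \<le> r + \<lambda>\<^sub>r - 1\<close>, since lists are indexed from 0.\<close>

definition diagram :: "nat list \<Rightarrow> (nat \<times> nat) set" where
  "diagram l = {(r, c). 1 \<le> r \<and> r \<le> length l \<and> r \<le> c \<and> c < r + l ! (r - 1)}"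

text \<open>A filling carries the pair \<open>\<lambda>/\<mu>\<close> (outer and inner partition) rather than only the set of boxes
  \<open>\<lambda> - \<mu>\<close>, because inner slides depend on \<open>\<mu>\<close>.\<close>

record 'a filling =
  outer :: "nat list"
  inner :: "nat list"
  entry :: "nat \<times> nat \<Rightarrow> 'a option"

definition shape :: "'a filling \<Rightarrow> nat list \<times> nat list" where
  "shape T = (outer T, inner T)"

definition boxes :: "'a filling \<Rightarrow> (nat \<times> nat) set" where
  "boxes T = diagram (outer T) - diagram (inner T)"

definition skew_filling :: "'a filling \<Rightarrow> bool" where
  "skew_filling T \<longleftrightarrow>
     strict_partition (outer T) \<and> strict_partition (inner T) \<and>
     diagram (inner T) \<subseteq> diagram (outer T) \<and> dom (entry T) = boxes T"

text \<open>The boxes in reading order: bottom row to top row, each row from left to right.\<close>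

definition reading_boxes :: "'a filling \<Rightarrow> (nat \<times> nat) list" where
  "reading_boxes T =
     filter (\<lambda>b. b \<notin> diagram (inner T))
       (concat (map (\<lambda>r. map (Pair r) [r..<r + outer T ! (r - 1)])
          (rev [1..<Suc (length (outer T))])))"

definition reading_word :: "'a filling \<Rightarrow> 'a list" where
  "reading_word T = map (\<lambda>b. the (entry T b)) (reading_boxes T)"

definition ss_tableau :: "letter filling \<Rightarrow> bool" where
  "ss_tableau T \<longleftrightarrow>
     skew_filling T \<and>
     (\<forall>r c c' a b. c < c' \<and> entry T (r, c) = Some a \<and> entry T (r, c') = Some b \<longrightarrow>
        a \<le> b \<and> (a = b \<longrightarrow> \<not> is_primed a)) \<and>
     (\<forall>r r' c a b. r < r' \<and> entry T (r, c) = Some a \<and> entry T (r', c) = Some b \<longrightarrow>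
        a \<le> b \<and> (a = b \<longrightarrow> is_primed a)) \<and>
     is_word (reading_word T)"

definition weight :: "letter filling \<Rightarrow> nat \<Rightarrow> nat" where
  "weight T = wt (reading_word T)"

definition std :: "letter filling \<Rightarrow> nat filling" where
  "std T =
     \<lparr>outer = outer T, inner = inner T,
      entry = map_of (zip (reading_boxes T) (standardization (reading_word T)))\<rparr>"


section \<open>Jeu de taquin and rectification\<close>

text \<open>A state is a pair of the current entries and the position of the empty box.\<close>

inductive slide_move ::
  "(nat \<times> nat \<Rightarrow> nat option) \<times> (nat \<times> nat) \<Rightarrow> (nat \<times> nat \<Rightarrow> nat option) \<times> (nat \<times> nat) \<Rightarrow> bool"
where
  right: "f (r, c + 1) = Some a \<Longrightarrow> (\<And>b. f (r + 1, c) = Some b \<Longrightarrow> a < b) \<Longrightarrow>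
      slide_move (f, (r, c)) (f((r, c) := Some a, (r, c + 1) := None), (r, c + 1))"
| down: "f (r + 1, c) = Some a \<Longrightarrow> (\<And>b. f (r, c + 1) = Some b \<Longrightarrow> a < b) \<Longrightarrow>
      slide_move (f, (r, c)) (f((r, c) := Some a, (r + 1, c) := None), (r + 1, c))"

text \<open>\<open>inner_slide T T'\<close>: \<open>T'\<close> is the result of an inner slide on \<open>T\<close>.  The slide starts at a box \<open>b\<close>
  whose removal turns the inner partition of \<open>T\<close> into that of \<open>T'\<close>; the empty box ends at \<open>e\<close>, which
  is removed from the outer partition.\<close>

definition inner_slide :: "letter filling \<Rightarrow> letter filling \<Rightarrow> bool" where
  "inner_slide T T' \<longleftrightarrow>
     ss_tableau T \<and> ss_tableau T' \<and> weight T' = weight T \<and>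
     (\<exists>b r c f. b \<in> diagram (inner T) \<and> diagram (inner T') = diagram (inner T) - {b} \<and>
        slide_move\<^sup>*\<^sup>* (entry (std T), b) (f, (r, c)) \<and>
        f (r, c + 1) = None \<and> f (r + 1, c) = None \<and>
        diagram (outer T') = diagram (outer T) - {(r, c)} \<and>
        entry (std T') = f)"

text \<open>\<open>R\<close> is obtained from \<open>T\<close> by inner slides, in some order, until the shape is straight (which is
  exactly when no inner slide is possible).\<close>

definition rectifies_to :: "letter filling \<Rightarrow> letter filling \<Rightarrow> bool" where
  "rectifies_to T R \<longleftrightarrow> ss_tableau T \<and> inner_slide\<^sup>*\<^sup>* T R \<and> inner R = []"

text \<open>\<open>R\<close> is \<open>rect(w)\<close>, computed from some tableau with reading word \<open>w\<close> and some order of slides.\<close>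

definition is_rect :: "letter list \<Rightarrow> letter filling \<Rightarrow> bool" where
  "is_rect w R \<longleftrightarrow> (\<exists>T. ss_tableau T \<and> reading_word T = w \<and> rectifies_to T R)"


section \<open>The lattice walk\<close>

text \<open>The letters with index \<open>i\<close> play the role of \<open>1', 1\<close>, the others that of \<open>2', 2\<close>.  The
  subtractions only occur when both coordinates are nonzero, so they are never truncated.\<close>

fun walk_step :: "nat \<Rightarrow> letter \<Rightarrow> nat \<times> nat \<Rightarrow> nat \<times> nat" where
  "walk_step i a (x, y) =
     (if x * y = 0 then (if idx a = i then (x + 1, y) else (x, y + 1))
      else (case a of
          Primed j \<Rightarrow> (if j = i then (x + 1, y) else (x - 1, y))
        | Unprimed j \<Rightarrow> (if j = i then (x, y - 1) else (x, y + 1))))"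

definition lattice_walk :: "nat \<Rightarrow> letter list \<Rightarrow> (nat \<times> nat) list" where
  "lattice_walk i w = map (\<lambda>k. fold (walk_step i) (take k w) (0, 0)) [0..<Suc (length w)]"

end

theory Submission
  imports Defs
begin

text \<open>
  Let \<open>(x, y)\<close> be the endpoint of the walk of \<open>w\<close>. The theorem follows from two facts: the endpoint does not
  change under inner slides (\<open>inner_slide_walk\<close>), and for the reading word of a straight tableau, whose
  shape has at most two rows \<open>\<lambda>\<^sub>1 > \<lambda>\<^sub>2\<close>, one has \<open>x + y = \<lambda>\<^sub>1 - \<lambda>\<^sub>2\<close> (\<open>straight_tableau_shape\<close>). So the
  endpoint and the length \<open>\<lambda>\<^sub>1 + \<lambda>\<^sub>2\<close> determine the shape of the rectification. The weight is determined
  because, at every point, letters of different index take different steps.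

  The reason for the invariance is that the steps of the letters, as maps of the quadrant into itself,
  satisfy the Knuth relations (\<open>knuth_right\<close>, \<open>knuth_left\<close>). Consider a slide. A horizontal move of the
  empty box does not change the reading word. A vertical move brings a letter \<open>x\<close> from a row \<open>C x D\<close> into
  the row \<open>A _ B\<close> above it, and thus changes the reading word from \<open>\<dots> C x D A B \<dots>\<close> to \<open>\<dots> C D A x B \<dots>\<close>.
  If each box of \<open>A\<close> has a box of \<open>C\<close> below it, then the Knuth relations imply that both words move every
  point in the same way (\<open>walk_slide_up\<close>). Otherwise \<open>A\<close> starts on the diagonal, and so do all rows below
  it. As there are only two indices, at most one box lies below the two rows (\<open>corner\<close>), so that the
  change takes place near the beginning of the word. There one may also use that the walk starts at
  the origin, from where the first two letters can be exchanged (\<open>walk_slide_up_diagonal\<close>,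
  \<open>walk_slide_up_corner\<close>).

  Slides are defined by means of standardizations, and the letters are only recovered at the end of a
  slide. In between, the argument uses any choice of letters that has the current entries as its
  standardization. The choice does not affect the endpoint: standardization and weight determine all
  letters except for the prime of the first letter of each index, and the walk ignores that prime
  (\<open>walk_origin_cong\<close>).
\<close>

section \<open>The walk and the Knuth relations\<close>

text \<open>\<open>precedes a b\<close> says that an entry \<open>a\<close> gets a smaller number than an entry \<open>b\<close> occurring later in the
  word, when the word is standardized: equal unprimed letters increase and equal primed letters
  decrease. If instead \<open>b\<close> gets the smaller number, then \<open>\<not> precedes a b\<close>.\<close>

definition precedes :: "letter \<Rightarrow> letter \<Rightarrow> bool" where
  "precedes a b \<longleftrightarrow> idx a < idx b \<or> idx a = idx b \<and> \<not> is_primed b"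

lemma precedes_trans: "precedes a b \<Longrightarrow> precedes b c \<Longrightarrow> precedes a c"
  by (auto simp: precedes_def)

lemma precedes_if_not_precedes: "precedes a b \<Longrightarrow> \<not> precedes a c \<Longrightarrow> precedes c b"
  by (auto simp: precedes_def)

lemma not_precedes_mono: "precedes a b \<Longrightarrow> \<not> precedes a c \<Longrightarrow> \<not> precedes b c"
  by (auto simp: precedes_def)

text \<open>An entry \<open>m\<close> lying between the earlier entries \<open>a\<close> and \<open>b\<close> in the standardization separates their
  indices: if \<open>a\<close> and \<open>b\<close> had the same index, then \<open>m\<close> would have to be both unprimed and primed.\<close>

lemma precedes_not_precedes_less:
  "precedes a m \<Longrightarrow> \<not> precedes b m \<Longrightarrow> idx a < idx b"
  by (auto simp: precedes_def)

locale two_letter_walk =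
  fixes i :: nat
begin

abbreviation letters :: "letter set" where
  "letters \<equiv> {a. idx a = i \<or> idx a = i + 1}"

definition walk :: "letter list \<Rightarrow> nat \<times> nat \<Rightarrow> nat \<times> nat" where
  "walk w = fold (walk_step i) w"

lemma walk_simps [simp]:
  "walk [] P = P"
  "walk (a # w) P = walk w (walk_step i a P)"
  "walk (u @ v) P = walk v (walk u P)"
  by (simp_all add: walk_def)

text \<open>The steps of the walk, regarded as maps of the quadrant into itself, satisfy the two Knuth
  relations \<open>yzx = yxz\<close> and \<open>xzy = zxy\<close> for \<open>x < y < z\<close> (in the order of the standardization).
  There are finitely many triples of letters, and each is a computation that distinguishes whether
  the point is on an axis before each step.\<close>

lemma knuth_right:
  assumes "{d, v, b} \<subseteq> letters" and "precedes d v" and "\<not> precedes d b"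
  shows "walk [d, v, b] P = walk [d, b, v] P"
  using assms
  by (cases d; cases v; cases b; cases P) (auto simp: precedes_def)

lemma knuth_left:
  assumes "{u, d, b} \<subseteq> letters" and "precedes u b" and "\<not> precedes d b"
  shows "walk [u, d, b] P = walk [d, u, b] P"
  using assms
  by (cases d; cases u; cases b; cases P) (auto simp: precedes_def)

lemma commute_over_row:
  assumes "set (d # V @ [b]) \<subseteq> letters" and "sorted_wrt precedes (d # V)" and "\<not> precedes d b"
  shows "walk (d # V @ [b]) P = walk (d # b # V) P"
  using assms
proof (induction V arbitrary: d P)
  case (Cons v V)
  have "\<not> precedes v b"
    using Cons.prems not_precedes_mono by auto
  then have "walk (v # V @ [b]) (walk_step i d P) = walk (v # b # V) (walk_step i d P)"
    using Cons by auto
  then show ?case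
    using knuth_right[of d v b P] Cons.prems by simp
qed simp

lemma row_bump_left:
  assumes "set (U @ [d, b]) \<subseteq> letters" and "sorted_wrt precedes (U @ [b])" and "\<not> precedes d b"
  shows "walk (U @ [d, b]) P = walk (d # U @ [b]) P"
  using assms
proof (induction U arbitrary: P)
  case (Cons u U)
  obtain h t where ht: "U @ [b] = h # t"
    by (cases "U @ [b]") auto
  have h: "h \<in> set (U @ [b])"
    using ht by simp
  have hb: "h = b \<or> precedes h b"
    using h Cons.prems(2) by (auto simp: sorted_wrt_append)
  have "\<not> precedes d h"
    using hb Cons.prems(3) precedes_trans by blast
  moreover have "precedes u h" "{u, d, h} \<subseteq> letters"
    using h Cons.prems by auto
  ultimately have "walk [u, d, h] P = walk [d, u, h] P"
    using knuth_left by blast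
  then have "walk (u # d # U @ [b]) P = walk (d # u # U @ [b]) P"
    using ht by simp
  moreover have "walk (U @ [d, b]) (walk_step i u P) = walk (d # U @ [b]) (walk_step i u P)"
    using Cons.prems by (intro Cons.IH) auto
  ultimately show ?case
    by simp
qed simp

text \<open>Inserting \<open>b\<close> into the row \<open>U @ d # V\<close> bumps \<open>d\<close>: by \<open>knuth_right\<close>, \<open>b\<close> moves to the left past \<open>V\<close>, and then by
  \<open>knuth_left\<close>, \<open>d\<close> moves to the left past \<open>U\<close>.\<close>

lemma row_bump:
  assumes "set (U @ d # V @ [b]) \<subseteq> letters"
    and "sorted_wrt precedes (U @ [b])" and "sorted_wrt precedes (d # V)" and "\<not> precedes d b"
  shows "walk (U @ d # V @ [b]) P = walk (d # U @ b # V) P"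
  using commute_over_row[of d V b "walk U P"] row_bump_left[of U d b P] assms by simp

text \<open>Bumping the entries of \<open>D\<close> one after the other by those of \<open>B\<close> replaces \<open>D\<close> by \<open>B\<close> in the row
  \<open>U @ D @ V\<close>.\<close>

lemma row_exchange:
  assumes "length D = length B" and "set (U @ D @ V @ B) \<subseteq> letters"
    and "sorted_wrt precedes (U @ D @ V)" and "sorted_wrt precedes (U @ B)"
    and "list_all2 (\<lambda>d b. \<not> precedes d b) D B"
  shows "walk (U @ D @ V @ B) P = walk (D @ U @ B @ V) P"
  using assms
proof (induction D B arbitrary: U P rule: list_induct2)
  case (Cons d D b B)
  have "walk (U @ d # (D @ V) @ [b]) P = walk (d # U @ b # D @ V) P"
    using Cons.prems by (intro row_bump) (auto simp: sorted_wrt_append)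
  moreover have "walk ((U @ [b]) @ D @ V @ B) Q = walk (D @ (U @ [b]) @ B @ V) Q" for Q
  proof (intro Cons.IH)
    have "precedes b z" if "z \<in> set (D @ V)" for z
      using that Cons.prems by (auto simp: sorted_wrt_append intro: precedes_if_not_precedes)
    then show "sorted_wrt precedes ((U @ [b]) @ D @ V)"
      using Cons.prems by (auto simp: sorted_wrt_append)
  qed (use Cons.prems in auto)
  ultimately show ?case
    by simp
qed simp

text \<open>This is a vertical move of the empty box: the lower row is \<open>C x D\<close>, the upper row is \<open>A\<close>, the empty
  box, \<open>B\<close>, and \<open>x\<close> moves up into the empty box. The entries of \<open>C\<close> lie below those of \<open>A\<close> and the entries
  of \<open>D\<close> below the first ones of \<open>B\<close>. First \<open>A\<close> bumps \<open>C\<close>, which leads to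
  \<open>C A x D B\<close>; then the beginning of \<open>B\<close> bumps \<open>D\<close> out of the row \<open>A x D\<close>.\<close>

lemma walk_slide_up:
  assumes letters: "set (C @ A @ x # D @ B) \<subseteq> letters"
    and len: "length A = length C" "length D \<le> length B"
    and rows: "sorted_wrt precedes (C @ x # D)" "sorted_wrt precedes (A @ x # B)"
    and cols: "list_all2 (\<lambda>c a. \<not> precedes c a) C A"
      "list_all2 (\<lambda>d b. \<not> precedes d b) D (take (length D) B)"
  shows "walk (C @ x # D @ A @ B) P = walk (C @ D @ A @ x # B) P"
proof -
  define B1 B2 where "B1 = take (length D) B" and "B2 = drop (length D) B"
  have B: "B = B1 @ B2" "length B1 = length D"
    using len by (simp_all add: B1_def B2_def)
  have cols1: "list_all2 (\<lambda>d b. \<not> precedes d b) D B1"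
    using cols by (simp add: B1_def)
  have "walk ([] @ C @ (x # D) @ A) P = walk (C @ [] @ A @ (x # D)) P"
    using letters len rows cols
    by (intro row_exchange[of C A "[]" "x # D"]) (auto simp: sorted_wrt_append)
  moreover have "sorted_wrt precedes ((A @ [x]) @ D @ [])"
    using rows by (auto simp: sorted_wrt_append intro: precedes_trans)
  then have "walk ((A @ [x]) @ D @ [] @ B1) Q = walk (D @ (A @ [x]) @ B1 @ []) Q" for Q
    using letters rows cols1 B
    by (intro row_exchange[of D B1 "A @ [x]" "[]"]) (auto simp: sorted_wrt_append)
  ultimately show ?thesis
    using B by simp
qed

text \<open>Near the diagonal the Knuth relations do not suffice: there an entry of the upper row may have no
  box below it. Such a move only happens near the beginning of the word, and from the origin the
  first two letters may be exchanged, as in the shifted Knuth relations of Sagan and Worley.\<close>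

lemma walk_origin_swap:
  assumes "{a, b} \<subseteq> letters"
  shows "walk [a, b] (0, 0) = walk [b, a] (0, 0)"
  using assms by (cases a; cases b) auto

text \<open>Here \<open>a\<close> is the diagonal entry of the upper row, which is smaller than the first entry of the lower
  row. The Knuth relations take it to the second place of the word and the exchange at the origin to
  the first place, where it is out of the way (or, if \<open>C\<close> is empty, where it becomes a part of the row
  that bumps \<open>D\<close>).\<close>

lemma walk_slide_up_diagonal:
  assumes letters: "set (a # C @ A @ x # D @ B) \<subseteq> letters"
    and len: "length A = length C" "length D \<le> length B"
    and rows: "sorted_wrt precedes (C @ x # D)" "sorted_wrt precedes (a # A @ x # B)"
    and cols: "list_all2 (\<lambda>c a. \<not> precedes c a) C A"
      "list_all2 (\<lambda>d b. \<not> precedes d b) D (take (length D) B)"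
    and diag: "\<not> precedes (hd (C @ [x])) a"
  shows "walk (C @ x # D @ a # A @ B) (0, 0) = walk (C @ D @ a # A @ x # B) (0, 0)"
proof (cases C)
  case (Cons c C')
  have front: "walk (c # V @ [a]) (0, 0) = walk (a # c # V) (0, 0)"
    if "set V \<subseteq> letters" "sorted_wrt precedes (c # V)" for V
    using commute_over_row[of c V a "(0, 0)"] walk_origin_swap[of a c] letters diag that Cons
    by simp
  have V1: "walk (c # (C' @ x # D) @ [a]) (0, 0) = walk (a # c # C' @ x # D) (0, 0)"
    using letters rows Cons by (intro front) auto
  have V2: "walk (c # (C' @ D) @ [a]) (0, 0) = walk (a # c # C' @ D) (0, 0)"
    using letters rows Cons by (intro front) (auto simp: sorted_wrt_append)
  have "walk (C @ x # D @ A @ B) Q = walk (C @ D @ A @ x # B) Q" for Q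
    using letters len rows cols by (intro walk_slide_up) auto
  then show ?thesis
    using V1 V2 Cons by simp
next
  case Nil
  then have [simp]: "A = []"
    using len by simp
  define B1 B2 where "B1 = take (length D) B" and "B2 = drop (length D) B"
  have B: "B = B1 @ B2" "length B1 = length D"
    using len by (simp_all add: B1_def B2_def)
  have cols1: "list_all2 (\<lambda>d b. \<not> precedes d b) D B1"
    using cols by (simp add: B1_def)
  have "walk (x # D @ [a]) (0, 0) = walk (x # a # D) (0, 0)"
    using letters rows diag Nil by (intro commute_over_row) auto
  also have "\<dots> = walk (a # x # D) (0, 0)"
    using walk_origin_swap[of a x] letters by simp
  finally have 1: "walk (x # D @ [a]) (0, 0) = walk (a # x # D) (0, 0)" .
  have "sorted_wrt precedes ([a, x] @ D @ [])"
    using rows Nil by (auto intro: precedes_trans)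
  then have "walk ([a, x] @ D @ [] @ B1) (0, 0) = walk (D @ [a, x] @ B1 @ []) (0, 0)"
    using letters rows cols1 B
    by (intro row_exchange[of D B1 "[a, x]" "[]"]) (auto simp: sorted_wrt_append)
  then show ?thesis
    using 1 B Nil by simp
qed

lemma walk_axis:
  "\<forall>a \<in> set w. idx a \<noteq> i \<Longrightarrow> walk w (0, y) = (0, y + length w)"
  "\<forall>a \<in> set w. idx a = i \<Longrightarrow> walk w (x, 0) = (x + length w, 0)"
  by (induction w arbitrary: x y) auto

lemma walk_up:
  "\<forall>a \<in> set w. idx a \<noteq> i \<and> \<not> is_primed a \<Longrightarrow> walk w (x, y) = (x, y + length w)"
  by (induction w arbitrary: x y) (auto split: letter.split)

text \<open>The only vertical move near the diagonal with further boxes below: a single box with entry \<open>s\<close>. With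
  \<open>1\<close> and \<open>2\<close> for \<open>i\<close> and \<open>i + 1\<close>, the hypotheses leave essentially one word, \<open>2 1 2' 2 \<dots> 2 1'\<close>, which
  becomes \<open>2 2' 2 \<dots> 2 1' 1\<close>; both walks go to \<open>(1, length D)\<close>.\<close>

lemma walk_slide_up_corner:
  assumes letters: "set (a # s # x # D) \<subseteq> letters" and "D \<noteq> []"
    and "idx x < idx s" and "precedes a x" and "\<not> precedes x a"
    and "idx x < idx (hd D)" and "\<not> precedes s (hd D)" and "sorted_wrt precedes D"
    and "\<not> is_primed x"
  shows "walk (s # x # D @ [a]) (0, 0) = walk (s # D @ [a, x]) (0, 0)"
proof -
  obtain d D' where D: "D = d # D'"
    using assms by (cases D) auto
  have x: "idx x = i" and s: "idx s = i + 1" and d: "idx d = i + 1"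
    using assms D by auto
  have a: "idx a = i" "is_primed a"
    using assms x by (auto simp: precedes_def)
  have dp: "is_primed d"
    using assms D s d by (auto simp: precedes_def)
  have D': "\<forall>z \<in> set D'. idx z \<noteq> i \<and> \<not> is_primed z"
    using assms D d by (fastforce simp: precedes_def)
  show ?thesis
    using x s d a dp D walk_axis(1)[of D'] D' \<open>\<not> is_primed x\<close>
    by (cases x; cases s; cases d; cases a) auto
qed

lemma walk_down:
  "\<forall>a \<in> set w. idx a = i \<and> \<not> is_primed a \<Longrightarrow> length w < y \<Longrightarrow>
    walk w (Suc 0, y) = (Suc 0, y - length w)"
proof (induction w arbitrary: y)
  case (Cons a w)
  then show ?case
    by (cases a) auto
qed simp

definition spread :: "nat \<times> nat \<Rightarrow> nat" where
  "spread P = fst P + snd P"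

lemma spread_walk_row:
  assumes "set w \<subseteq> letters" and "sorted_wrt precedes w"
  shows "spread (walk w (x, 0)) = x + length w"
  using assms
proof (induction w arbitrary: x)
  case (Cons a w)
  show ?case
  proof (cases "idx a = i")
    case True
    then show ?thesis
      using Cons by simp
  next
    case False
    then have "\<forall>z \<in> set w. idx z \<noteq> i \<and> \<not> is_primed z"
      using Cons.prems by (fastforce simp: precedes_def)
    then show ?thesis
      using False by (simp add: walk_up spread_def)
  qed
qed (simp add: spread_def)

text \<open>Write \<open>1\<close> and \<open>2\<close> for \<open>i\<close> and \<open>i + 1\<close>. The walk of a straight tableau with first row \<open>w\<close> and nonempty
  second row \<open>u\<close> runs up the \<open>y\<close>-axis along \<open>u\<close> and then, after one step to the right, down again: the
  conditions on rows and columns force the entries of \<open>w\<close> above \<open>u\<close> to be \<open>1\<close>, except that the last one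
  may be \<open>2'\<close>. So these entries bring the walk to \<open>(1, 0)\<close> or \<open>(0, 1)\<close>, and each of the remaining
  entries of \<open>w\<close> moves it one step away from the origin.\<close>

lemma spread_walk_straight:
  assumes letters: "set (u @ w) \<subseteq> letters" and len: "length u < length w"
    and row: "sorted_wrt precedes w"
    and u: "\<forall>b \<in> set u. idx b = i + 1"
    and corner: "u \<noteq> [] \<Longrightarrow> idx (hd w) = i"
    and cols: "\<And>k. k < length u \<Longrightarrow> \<not> precedes (u ! k) (w ! Suc k)"
  shows "spread (walk (u @ w) (0, 0)) + length u = length w"
proof (cases u rule: rev_cases)
  case Nil
  then show ?thesis
    using spread_walk_row[of w 0] letters row by simp
next
  case (snoc u' b)
  obtain r w' where w': "w = r # w'"
    using len by (cases w) auto
  define A z B where "A = take (length u') w'" and "z = w' ! length u'"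
    and "B = drop (Suc (length u')) w'"
  have "w' = A @ z # B"
    unfolding A_def z_def B_def using len snoc w' by (intro id_take_nth_drop) auto
  then have w: "w = r # A @ z # B"
    using w' by simp
  have A_len: "length A = length u'"
    using len snoc w' by (simp add: A_def)
  have idx_u: "idx (u ! k) = i + 1" if "k < length u" for k
    using u that by simp
  have hdw: "idx r = i"
    using corner snoc w by simp
  have row': "sorted_wrt precedes (r # A @ z # B)"
    using row w by simp
  have zc: "idx z = i \<and> \<not> is_primed z \<or> idx z = i + 1 \<and> is_primed z"
  proof -
    have "\<not> precedes (u ! length u') z"
      using cols[of "length u'"] snoc w' by (simp add: z_def)
    moreover have "idx z = i \<or> idx z = i + 1"
      using letters w by simp
    moreover have "precedes r z"
      using row' by (simp add: sorted_wrt_append)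
    moreover have "idx (u ! length u') = i + 1"
      using idx_u[of "length u'"] snoc by simp
    ultimately show ?thesis
      using hdw unfolding precedes_def by linarith
  qed
  have Ac: "\<forall>a \<in> set A. idx a = i \<and> \<not> is_primed a"
  proof
    fix a assume "a \<in> set A"
    have "precedes r a" "precedes a z"
      using row' \<open>a \<in> set A\<close> by (auto simp: sorted_wrt_append)
    moreover obtain k where k: "k < length u'" "a = A ! k"
      using \<open>a \<in> set A\<close> A_len by (auto simp: in_set_conv_nth)
    have "w ! Suc k = a"
      using k A_len w by (simp add: nth_append)
    then have "\<not> precedes (u ! k) a"
      using cols[of k] k snoc by simp
    moreover have "idx (u ! k) = i + 1"
      using idx_u[of k] k snoc by simp
    ultimately show "idx a = i \<and> \<not> is_primed a"
      using zc hdw unfolding precedes_def by linarith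
  qed
  have "walk (u @ r # A) (0, 0) = (1, 1)"
    using walk_axis(1)[of u 0] u hdw walk_down[OF Ac, of "length u"] A_len snoc by simp
  then have start: "walk (u @ w) (0, 0) = walk (z # B) (1, 1)"
    using w by simp
  have len_w: "length w = length u + Suc (length B)"
    using A_len snoc w by simp
  show ?thesis
  proof (cases "idx z = i")
    case True
    have "sorted_wrt precedes B" "set B \<subseteq> letters"
      using row' letters w by (auto simp: sorted_wrt_append)
    then have "spread (walk B (1, 0)) = Suc (length B)"
      using spread_walk_row by simp
    moreover have "walk (z # B) (1, 1) = walk B (1, 0)"
      using True zc by (cases z) auto
    ultimately show ?thesis
      using start len_w by simp
  next
    case False
    have "set B \<subseteq> letters"
      using letters w by auto
    then have "\<forall>b \<in> set B. idx b \<noteq> i \<and> \<not> is_primed b"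
      using False zc row' by (fastforce simp: precedes_def sorted_wrt_append)
    moreover have "walk (z # B) (1, 1) = walk B (0, 1)"
      using False zc by (cases z) auto
    ultimately show ?thesis
      using start len_w by (simp add: walk_up spread_def)
  qed
qed

text \<open>The prime of a letter that is not the first of its index is determined by its comparison with an
  earlier letter of the same index. The prime of the first letter of its index does not matter: when
  it is read, the walk has only seen the other index and is therefore on an axis. So the endpoint
  depends only on the standardization and the weight.\<close>

lemma walk_origin_cong:
  assumes "length u = length v" and "\<And>k. k < length u \<Longrightarrow> idx (u ! k) = idx (v ! k)"
    and "\<And>j k. j < k \<Longrightarrow> k < length u \<Longrightarrow>
      precedes (u ! j) (u ! k) \<longleftrightarrow> precedes (v ! j) (v ! k)"
    and "set u \<subseteq> letters"
  shows "walk u (0, 0) = walk v (0, 0)"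
  using assms
proof (induction u v rule: rev_induct2)
  case (4 a u b v)
  have len: "length u = length v"
    using 4 by simp
  have IH: "walk u (0, 0) = walk v (0, 0)"
  proof (rule 4)
    fix k assume "k < length u"
    then show "idx (u ! k) = idx (v ! k)"
      using "4.prems"(2)[of k] len by (simp add: nth_append)
  next
    fix j k assume "j < k" "k < length u"
    then show "precedes (u ! j) (u ! k) \<longleftrightarrow> precedes (v ! j) (v ! k)"
      using "4.prems"(3)[of j k] len by (simp add: nth_append)
  qed (use "4.prems" in auto)
  have ab: "idx a = idx b"
    using "4.prems"(2)[of "length u"] len by (simp add: nth_append)
  show ?case
  proof (cases "idx a \<in> idx ` set u")
    case True
    then obtain j where j: "j < length u" "idx (u ! j) = idx a"
      by (auto simp: in_set_conv_nth)
    then have "idx (v ! j) = idx a"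
      using "4.prems"(2)[of j] len by (simp add: nth_append)
    moreover have "precedes (u ! j) a \<longleftrightarrow> precedes (v ! j) b"
      using "4.prems"(3)[of j "length u"] len j by (simp add: nth_append)
    ultimately have "a = b"
      using ab j by (cases a; cases b) (auto simp: precedes_def)
    then show ?thesis
      using IH by simp
  next
    case False
    then have "fst (walk u (0, 0)) = 0 \<or> snd (walk u (0, 0)) = 0"
    proof (cases "idx a = i")
      case True
      then have "\<forall>z \<in> set u. idx z \<noteq> i"
        using False by (metis image_eqI)
      then show ?thesis
        using walk_axis(1)[of u 0] by simp
    next
      case False': False
      then have "idx a = i + 1"
        using "4.prems"(4) by simp
      then have "idx z = i" if "z \<in> set u" for z
        using that False "4.prems"(4) by (metis (mono_tags, lifting) image_eqI mem_Collect_eq set_append subset_code(1) UnI1)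
      then show ?thesis
        using walk_axis(2)[of u 0] by simp
    qed
    then show ?thesis
      using IH ab by (cases "walk v (0, 0)") auto
  qed
qed simp_all

end

section \<open>Letterings of standard fillings\<close>

definition before :: "nat \<times> nat \<Rightarrow> nat \<times> nat \<Rightarrow> bool" where
  "before p q \<longleftrightarrow> fst q < fst p \<or> fst p = fst q \<and> snd p < snd q"

lemma before_total: "p \<noteq> q \<Longrightarrow> before p q \<or> before q p"
  by (auto simp: before_def prod_eq_iff)

lemma before_asym: "before p q \<Longrightarrow> \<not> before q p"
  by (auto simp: before_def)

definition reads :: "(nat \<times> nat) list \<Rightarrow> (nat \<times> nat) set \<Rightarrow> bool" where
  "reads ps X \<longleftrightarrow> sorted_wrt before ps \<and> set ps = X"

lemma reads_unique:
  assumes "reads ps X" and "reads qs X"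
  shows "ps = qs"
proof -
  have "sorted_wrt before ps \<Longrightarrow> sorted_wrt before qs \<Longrightarrow> set ps = set qs \<Longrightarrow> ps = qs"
    for ps qs
  proof (induction ps arbitrary: qs)
    case (Cons p ps)
    then obtain q qs' where qs: "qs = q # qs'"
      by (cases qs) auto
    have "p = q"
      using Cons.prems qs before_asym by (metis list.set_intros(1) set_ConsD sorted_wrt.simps(2))
    moreover have "set ps = set qs'"
    proof -
      have "p \<notin> set ps" "q \<notin> set qs'"
        using Cons.prems qs before_asym[of p p] before_asym[of q q] by auto
      then show ?thesis
        using Cons.prems(3) qs \<open>p = q\<close> by auto
    qed
    ultimately show ?case
      using Cons qs by auto
  qed simp
  then show ?thesis
    using assms by (auto simp: reads_def)
qed

lemma reads_distinct:
  assumes "reads ps X"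
  shows "distinct ps"
proof -
  have "sorted_wrt before ps \<Longrightarrow> distinct ps"
  proof (induction ps)
    case (Cons p ps)
    then show ?case
      using before_asym[of p p] by auto
  qed simp
  then show ?thesis
    using assms by (simp add: reads_def)
qed

definition standard :: "(nat \<times> nat) set \<Rightarrow> (nat \<times> nat \<Rightarrow> nat) \<Rightarrow> bool" where
  "standard X F \<longleftrightarrow> inj_on F X \<and>
     (\<forall>p \<in> X. \<forall>q \<in> X. p \<noteq> q \<and> fst p \<le> fst q \<and> snd p \<le> snd q \<longrightarrow> F p < F q)"

lemma standardD:
  "standard X F \<Longrightarrow> p \<in> X \<Longrightarrow> q \<in> X \<Longrightarrow> p \<noteq> q \<Longrightarrow> fst p \<le> fst q \<Longrightarrow> snd p \<le> snd q \<Longrightarrow> F p < F q"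
  by (simp add: standard_def)

context two_letter_walk
begin

text \<open>A slide acts on the standardization \<open>F\<close> of a tableau. To speak about words while the empty box is
  moving, \<open>F\<close> is accompanied by letters \<open>G\<close> with standardization \<open>F\<close>. They need not be in canonical form,
  and \<open>F\<close> only matters up to its order.\<close>

definition lettering ::
  "(nat \<times> nat) set \<Rightarrow> (nat \<times> nat \<Rightarrow> nat) \<Rightarrow> (nat \<times> nat \<Rightarrow> letter) \<Rightarrow> bool" where
  "lettering X F G \<longleftrightarrow> G ` X \<subseteq> letters \<and>
     (\<forall>p \<in> X. \<forall>q \<in> X. before p q \<longrightarrow> (F p < F q \<longleftrightarrow> precedes (G p) (G q)))"

lemma letteringD:
  "lettering X F G \<Longrightarrow> p \<in> X \<Longrightarrow> q \<in> X \<Longrightarrow> before p q \<Longrightarrow> F p < F q \<longleftrightarrow> precedes (G p) (G q)"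
  by (simp add: lettering_def)

lemma lettering_letters: "lettering X F G \<Longrightarrow> p \<in> X \<Longrightarrow> idx (G p) = i \<or> idx (G p) = i + 1"
  by (auto simp: lettering_def)

lemma lettering_mono:
  assumes "lettering X F G" and "p \<in> X" and "q \<in> X" and "F p < F q"
  shows "idx (G p) \<le> idx (G q)"
proof -
  have "p \<noteq> q"
    using assms by auto
  then show ?thesis
    using before_total[of p q] letteringD[OF assms(1), of p q] letteringD[OF assms(1), of q p] assms
    by (auto simp: precedes_def)
qed

lemma lettering_less:
  assumes "lettering X F G" and "inj_on F X" and "p \<in> X" and "q \<in> X" and "idx (G p) < idx (G q)"
  shows "F p < F q"
proof -
  have "F p \<noteq> F q"
    using inj_onD[OF assms(2) _ assms(3,4)] assms(5) by auto
  then show ?thesis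
    using lettering_mono[OF assms(1,4,3)] assms(5) by linarith
qed

text \<open>Of three boxes in increasing order of \<open>F\<close> such that the middle one is read last, the first and the
  third have letters of different index. As there are only two indices, chains of such triples, for
  instance along the diagonal of a shifted tableau, are short.\<close>

lemma lettering_strict:
  assumes "lettering X F G" and "p \<in> X" and "m \<in> X" and "q \<in> X"
    and "before p m" and "before q m" and "F p < F m" and "F m < F q"
  shows "idx (G p) < idx (G q)"
  using letteringD[OF assms(1), of p m] letteringD[OF assms(1), of q m] assms(2-)
  by (auto simp: precedes_def)

lemma lettering_walk_unique:
  assumes "lettering X F G" and "lettering X F G'" and ps: "reads ps X"
    and idx: "\<And>p. p \<in> X \<Longrightarrow> idx (G p) = idx (G' p)"
  shows "walk (map G ps) (0, 0) = walk (map G' ps) (0, 0)"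
proof (rule walk_origin_cong)
  fix j k assume jk: "j < k" "k < length (map G ps)"
  then have "before (ps ! j) (ps ! k)" "ps ! j \<in> X" "ps ! k \<in> X"
    using ps by (auto simp: reads_def sorted_wrt_iff_nth_less)
  then show "precedes (map G ps ! j) (map G ps ! k) \<longleftrightarrow> precedes (map G' ps ! j) (map G' ps ! k)"
    using letteringD[OF assms(1)] letteringD[OF assms(2)] jk by auto
next
  fix k assume "k < length (map G ps)"
  then have "ps ! k \<in> X"
    using ps by (auto simp: reads_def)
  then show "idx (map G ps ! k) = idx (map G' ps ! k)"
    using idx \<open>k < length (map G ps)\<close> by simp
qed (use assms in \<open>auto simp: reads_def lettering_def\<close>)

text \<open>The boxes with a letter of index \<open>i\<close> are those with the smallest values of \<open>F\<close>, and the weight says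
  how many they are.\<close>

lemma lettering_idx_unique:
  assumes 1: "lettering X F G" and 2: "lettering X F G'" and ps: "reads ps X"
    and inj: "inj_on F X" and wt: "wt (map G ps) i = wt (map G' ps) i" and "p \<in> X"
  shows "idx (G p) = idx (G' p)"
proof -
  define J where "J H = {p \<in> X. idx (H p) = i}" for H :: "nat \<times> nat \<Rightarrow> letter"
  have card: "card (J H) = wt (map H ps) i" for H
  proof -
    have "J H = set (filter (\<lambda>p. idx (H p) = i) ps)"
      using ps by (auto simp: J_def reads_def)
    then show ?thesis
      using distinct_card[OF distinct_filter[OF reads_distinct[OF ps]]]
      by (simp add: wt_def filter_map comp_def)
  qed
  have "finite X"
    using ps by (auto simp: reads_def)
  then have fin: "finite (J H)" for H
    by (simp add: J_def)
  have less: "F p < F q" if "p \<in> J G - J G'" "q \<in> J G' - J G" for p q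
    using that lettering_less[OF 1 inj, of p q] lettering_letters[OF 1, of q] by (auto simp: J_def)
  have less': "F q < F p" if "p \<in> J G - J G'" "q \<in> J G' - J G" for p q
    using that lettering_less[OF 2 inj, of q p] lettering_letters[OF 2, of p] by (auto simp: J_def)
  have "J G \<subseteq> J G' \<or> J G' \<subseteq> J G"
    using less less' by (meson DiffI less_asym subsetI)
  then have "J G = J G'"
    using card fin wt by (metis card_subset_eq)
  then show ?thesis
    using lettering_letters[OF 1 \<open>p \<in> X\<close>] lettering_letters[OF 2 \<open>p \<in> X\<close>] \<open>p \<in> X\<close>
    unfolding J_def by (metis (mono_tags, lifting) mem_Collect_eq)
qed

lemma row_sorted:
  assumes "standard X F" and "lettering X F G"
    and "\<And>c. c \<in> set cs \<Longrightarrow> (r, c) \<in> X" and "sorted_wrt (<) cs"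
  shows "sorted_wrt precedes (map (\<lambda>c. G (r, c)) cs)"
  unfolding sorted_wrt_map
proof (rule sorted_wrt_mono_rel[OF _ assms(4)])
  fix c c' assume c: "c \<in> set cs" "c' \<in> set cs" "c < c'"
  then show "precedes (G (r, c)) (G (r, c'))"
    using letteringD[OF assms(2), of "(r, c)" "(r, c')"] standardD[OF assms(1), of "(r, c)" "(r, c')"]
      assms(3)[of c] assms(3)[of c'] by (auto simp: before_def)
qed

lemma column_not_precedes:
  assumes "standard X F" and "lettering X F G" and "(r, c) \<in> X" and "(r', c) \<in> X" and "r < r'"
  shows "\<not> precedes (G (r', c)) (G (r, c))"
  using letteringD[OF assms(2), of "(r', c)" "(r, c)"] standardD[OF assms(1), of "(r, c)" "(r', c)"]
    assms(3-) by (auto simp: before_def)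

end

section \<open>Moves of the empty box\<close>

text \<open>Row \<open>r\<close> of a shifted skew shape occupies the columns from \<open>s r\<close> to \<open>e r - 1\<close>. Either a row starts
  weakly to the right of the next one, or it starts on the diagonal, and then so do all rows below it.\<close>

locale skew_region = two_letter_walk +
  fixes s e :: "nat \<Rightarrow> nat"
  assumes start_ge: "r \<le> s r"
    and start_step: "1 \<le> r \<Longrightarrow> s (Suc r) \<le> s r \<or> s r = r \<and> s (Suc r) = Suc r"
    and end_step: "1 \<le> r \<Longrightarrow> Suc r < e (Suc r) \<Longrightarrow> e (Suc r) \<le> e r"
begin

definition region :: "(nat \<times> nat) set" where
  "region = {(r, c). 1 \<le> r \<and> s r \<le> c \<and> c < e r}"

lemma in_region [simp]: "(r, c) \<in> region \<longleftrightarrow> 1 \<le> r \<and> s r \<le> c \<and> c < e r"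
  by (simp add: region_def)

lemma end_antimono:
  assumes "1 \<le> r" and "r \<le> r'" and "r' \<le> c" and "c < e r'"
  shows "c < e r"
  using assms(2-)
proof (induction r' rule: dec_induct)
  case (step n)
  then show ?case
    using end_step[of n] assms(1) by auto
qed

lemma straight_start:
  assumes "1 \<le> r" and "s r = r" and "r \<le> r'"
  shows "s r' = r'"
  using assms(3)
proof (induction r' rule: dec_induct)
  case (step n)
  then show ?case
    using start_step[of n] start_ge[of "Suc n"] assms(1) by auto
qed (use assms in simp)

lemma region_corner:
  assumes "(r, c) \<in> region" and "(r', c') \<in> region" and "r \<le> r'" and "c \<le> c'"
  shows "(r, c') \<in> region"
  using assms end_antimono[of r r' c'] start_ge[of r'] by auto

text \<open>The entry that moves into \<open>(r, c)\<close> has to be smaller than all entries weakly southeast of this box.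
  Each of them is weakly southeast of the right or of the lower neighbour of \<open>(r, c)\<close>, and \<open>y\<close> is the
  neighbour with the smaller entry.\<close>

lemma standard_move:
  assumes std: "standard (region - {(r, c)}) F" and h: "(r, c) \<in> region"
    and y: "y \<in> region" "y = (r, c + 1) \<or> y = (r + 1, c)"
    and min: "\<And>z. z \<in> region \<Longrightarrow> z = (r, c + 1) \<or> z = (r + 1, c) \<Longrightarrow> z \<noteq> y \<Longrightarrow> F y < F z"
  shows "standard (region - {y}) (F((r, c) := F y))"
proof -
  let ?X = "region - {(r, c)}"
  have yX: "y \<in> ?X"
    using y by auto
  have up: "F y < F q" if q: "q \<in> ?X" "q \<noteq> y" "r \<le> fst q" "c \<le> snd q" for q
  proof -
    obtain z where z: "z \<in> region" "z = (r, c + 1) \<or> z = (r + 1, c)" "fst z \<le> fst q" "snd z \<le> snd q"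
    proof (cases "c < snd q")
      case True
      have "(r, snd q) \<in> region"
        using region_corner[OF h, of "fst q" "snd q"] q by simp
      then have "(r, c + 1) \<in> region"
        using True h by simp
      then show ?thesis
        using that[of "(r, c + 1)"] True q by simp
    next
      case False
      then have q': "q = (fst q, c)" "r < fst q"
        using q by (auto simp: prod_eq_iff)
      have "fst q \<le> c" "c < e (fst q)" "1 \<le> r" "s r \<le> c"
        using q(1) q'(1) start_ge[of "fst q"] h by (cases q; auto)+
      then have "(r + 1, c) \<in> region"
        using start_step[of r] q'(2) end_antimono[of "r + 1" "fst q" c] by auto
      then show ?thesis
        using that[of "(r + 1, c)"] q'(2) q(4) by simp
    qed
    then have "z \<in> ?X"
      by auto
    show ?thesis
    proof (cases "z = y")
      case True
      then show ?thesis
        using standardD[OF std yX q(1)] q z by auto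
    next
      case False
      then have "F y < F z"
        using min z by blast
      moreover have "F z \<le> F q"
        using standardD[OF std \<open>z \<in> ?X\<close> q(1)] z by (cases "z = q") auto
      ultimately show ?thesis
        by simp
    qed
  qed
  have down: "F p < F y" if p: "p \<in> ?X" "fst p \<le> r" "snd p \<le> c" for p
    using standardD[OF std p(1) yX] p y by (auto simp: prod_eq_iff)
  have "inj_on (F((r, c) := F y)) (region - {y})"
  proof (rule inj_onI)
    fix p q assume pq: "p \<in> region - {y}" "q \<in> region - {y}"
      and eq: "(F((r, c) := F y)) p = (F((r, c) := F y)) q"
    have "inj_on F ?X"
      using std by (simp add: standard_def)
    then show "p = q"
      using pq eq yX by (auto simp: inj_on_def split: if_splits)
  qed
  moreover have "(F((r, c) := F y)) p < (F((r, c) := F y)) q"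
    if "p \<in> region - {y}" "q \<in> region - {y}" "p \<noteq> q" "fst p \<le> fst q" "snd p \<le> snd q" for p q
    using that up[of q] down[of p] standardD[OF std, of p q] by auto
  ultimately show ?thesis
    by (auto simp: standard_def)
qed

end

abbreviation seg :: "nat \<Rightarrow> nat \<Rightarrow> nat \<Rightarrow> (nat \<times> nat) list" where
  "seg r a b \<equiv> map (Pair r) [a..<b]"

lemma upt_split: "a \<le> b \<Longrightarrow> b \<le> c \<Longrightarrow> [a..<c] = [a..<b] @ [b..<c]"
  using upt_add_eq_append[of a b "c - b"] by simp

lemma wt_append [simp]: "wt (u @ v) n = wt u n + wt v n"
  by (simp add: wt_def)

lemma wt_Cons: "wt (a # v) n = (if idx a = n then 1 else 0) + wt v n"
  by (simp add: wt_def)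

context skew_region
begin

text \<open>In reading order \<open>(r, c + 1)\<close> comes directly after \<open>(r, c)\<close>, so it makes no difference to the reading
  word in which of the two boxes the letter stands.\<close>

lemma move_right:
  assumes lett: "lettering (region - {(r, c)}) F G" and ps: "reads ps (region - {(r, c)})"
    and h: "(r, c) \<in> region" "(r, Suc c) \<in> region"
  obtains G' ps' where "reads ps' (region - {(r, Suc c)})"
    and "lettering (region - {(r, Suc c)}) (F((r, c) := F (r, Suc c))) G'"
    and "map G' ps' = map G ps"
proof -
  let ?h = "(r, c)" and ?y = "(r, Suc c)"
  define t where "t p = (if p = ?y then ?h else p)" for p
  define u where "u p = (if p = ?h then ?y else p)" for p
  let ?G = "G(?h := G ?y)"
  have before_t: "before (t p) (t q)" if "before p q" "p \<noteq> ?h" "q \<noteq> ?h" for p q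
    using that by (auto simp: before_def t_def prod_eq_iff)
  have before_u: "before (u p) (u q)" if "before p q" "p \<noteq> ?y" "q \<noteq> ?y" for p q
    using that by (auto simp: before_def u_def prod_eq_iff)
  have "reads (map t ps) (region - {?y})"
    unfolding reads_def sorted_wrt_map
  proof
    show "sorted_wrt (\<lambda>p q. before (t p) (t q)) ps"
      by (rule sorted_wrt_mono_rel[of ps before]) (use ps before_t in \<open>auto simp: reads_def\<close>)
    show "set (map t ps) = region - {?y}"
    proof -
      have "t ` (region - {?h}) = (region - {?h, ?y}) \<union> t ` {?y}"
        using h(2) by (auto simp: t_def simp del: in_region)
      then show ?thesis
        using ps h by (auto simp: reads_def t_def simp del: in_region)
    qed
  qed
  moreover have "lettering (region - {?y}) (F(?h := F ?y)) ?G"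
    unfolding lettering_def
  proof (intro conjI ballI impI)
    have "idx (?G p) = i \<or> idx (?G p) = i + 1" if "p \<in> region - {?y}" for p
      using that lettering_letters[OF lett, of p] lettering_letters[OF lett, of ?y] h
      by (cases "p = ?h") (simp_all del: in_region)
    then show "?G ` (region - {?y}) \<subseteq> letters"
      by blast
  next
    fix p q assume pq: "p \<in> region - {?y}" "q \<in> region - {?y}" "before p q"
    then have "F (u p) < F (u q) \<longleftrightarrow> precedes (G (u p)) (G (u q))"
      using h by (intro letteringD[OF lett] before_u) (auto simp: u_def simp del: in_region)
    then show "(F(?h := F ?y)) p < (F(?h := F ?y)) q \<longleftrightarrow> precedes (?G p) (?G q)"
      by (simp add: u_def fun_upd_def if_distrib cong: if_cong)
  qed
  moreover have "map ?G (map t ps) = map G ps"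
    using ps by (auto simp: reads_def t_def)
  ultimately show ?thesis
    using that by blast
qed

end

text \<open>The situation in which the empty box \<open>(r, c)\<close> is about to move down.\<close>

locale slide_up = skew_region +
  fixes F :: "nat \<times> nat \<Rightarrow> nat" and G :: "nat \<times> nat \<Rightarrow> letter" and r c :: nat
  assumes hole: "(r, c) \<in> region" and below: "(Suc r, c) \<in> region"
    and std: "standard (region - {(r, c)}) F"
    and lett: "lettering (region - {(r, c)}) F G"
    and smaller: "(r, Suc c) \<in> region \<Longrightarrow> F (Suc r, c) < F (r, Suc c)"
begin

abbreviation X where "X \<equiv> region - {(r, c)}"
abbreviation X' where "X' \<equiv> region - {(Suc r, c)}"
abbreviation F' where "F' \<equiv> F((r, c) := F (Suc r, c))"
abbreviation G' where "G' \<equiv> G((r, c) := G (Suc r, c))"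

lemma rows: "1 \<le> r" "s r \<le> c" "s (Suc r) \<le> c" "c < e (Suc r)" "e (Suc r) \<le> e r" "Suc r \<le> c"
  using hole below start_ge[of "Suc r"] end_step[of r] by auto

lemma std': "standard X' F'"
  using standard_move[OF std hole below] smaller by auto

text \<open>The box of the upper row above an entry to the right of the moving one lies between the two, and is
  read after both; so their indices differ.\<close>

lemma right_larger:
  assumes "(Suc r, d) \<in> region" and "c < d"
  shows "(r, d) \<in> X" and "F (Suc r, c) < F (r, d)" and "F (r, d) < F (Suc r, d)"
    and "idx (G (Suc r, c)) < idx (G (Suc r, d))"
proof -
  show 1: "(r, d) \<in> X"
    using assms rows by auto
  show 2: "F (Suc r, c) < F (r, d)"
    using standardD[OF std', of "(r, c)" "(r, d)"] hole assms rows by auto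
  show 3: "F (r, d) < F (Suc r, d)"
    using standardD[OF std, of "(r, d)" "(Suc r, d)"] assms 1 by auto
  show "idx (G (Suc r, c)) < idx (G (Suc r, d))"
    using lettering_strict[OF lett _ 1, of "(Suc r, c)" "(Suc r, d)"] 2 3 below assms
    by (auto simp: before_def)
qed

text \<open>Only the entries read between the two positions of the moving letter can violate the conditions on
  the new letters. Those to its right in the lower row have a larger index. For those to the left of
  the empty box in the upper row the moving letter has to be unprimed if the index is the same; this
  holds because of an entry further to the left in the lower row, if there is one.\<close>

lemma lett':
  assumes diag: "s r = r \<Longrightarrow> c = Suc r \<Longrightarrow> \<not> is_primed (G (Suc r, c))"
  shows "lettering X' F' G'"
  unfolding lettering_def
proof (intro conjI ballI impI)
  have "idx (G' p) = i \<or> idx (G' p) = i + 1" if "p \<in> X'" for p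
    using that lettering_letters[OF lett, of p] lettering_letters[OF lett, of "(Suc r, c)"] below
    by (cases "p = (r, c)") (simp_all del: in_region)
  then show "G' ` X' \<subseteq> letters"
    by blast
next
  let ?y = "(Suc r, c)"
  fix p q assume p: "p \<in> X'" and q: "q \<in> X'" and pq: "before p q"
  have yX: "?y \<in> X"
    using below by simp
  consider "p = (r, c)" | "q = (r, c)" "before p ?y"
    | d where "q = (r, c)" "p = (Suc r, d)" "c < d"
    | a where "q = (r, c)" "p = (r, a)" "a < c"
    | "p \<noteq> (r, c)" "q \<noteq> (r, c)"
    using p pq by (cases p; cases q) (auto simp: before_def; linarith)
  then show "F' p < F' q \<longleftrightarrow> precedes (G' p) (G' q)"
  proof cases
    case 1
    then have "before ?y q"
      using pq by (auto simp: before_def)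
    then show ?thesis
      using letteringD[OF lett yX, of q] 1 pq q by (auto simp: before_def)
  next
    case 2
    then show ?thesis
      using letteringD[OF lett _ yX, of p] p pq by (auto simp: before_def)
  next
    case 3
    then show ?thesis
      using right_larger[of d] p by (auto simp: precedes_def)
  next
    case 4
    have a: "(r, a) \<in> X" "s r \<le> a"
      using p 4 by auto
    have less: "F (r, a) < F ?y"
      using standardD[OF std a(1) yX] 4 by auto
    then have le: "idx (G (r, a)) \<le> idx (G ?y)"
      using lettering_mono[OF lett a(1) yX] by simp
    have "precedes (G (r, a)) (G ?y)"
    proof (cases "s r = r \<and> c = Suc r")
      case True
      then show ?thesis
        using le diag by (auto simp: precedes_def)
    next
      case False
      define b where "b = max a (Suc r)"
      have b: "(Suc r, b) \<in> X" "b < c" "a \<le> b"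
        using False a 4 rows start_step[of r] start_ge[of r] by (auto simp: b_def max_def)
      have "F (r, a) < F (Suc r, b)" "F (Suc r, b) < F ?y"
        using standardD[OF std a(1) b(1)] standardD[OF std b(1) yX] b by auto
      then have "idx (G (r, a)) \<le> idx (G (Suc r, b))" "precedes (G (Suc r, b)) (G ?y)"
        using lettering_mono[OF lett a(1) b(1)] letteringD[OF lett b(1) yX] b
        by (auto simp: before_def)
      then show ?thesis
        by (auto simp: precedes_def)
    qed
    then show ?thesis
      using less 4 by simp
  next
    case 5
    then show ?thesis
      using letteringD[OF lett, of p q] p q pq by auto
  qed
qed

lemma reads_X:
  assumes "reads ps X"
  defines "P \<equiv> filter (\<lambda>p. Suc r < fst p) ps" and "Q \<equiv> filter (\<lambda>p. fst p < r) ps"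
  shows "ps = P @ seg (Suc r) (s (Suc r)) c @ (Suc r, c) # seg (Suc r) (Suc c) (e (Suc r))
      @ seg r (s r) c @ seg r (Suc c) (e r) @ Q"
    and "reads (P @ seg (Suc r) (s (Suc r)) c @ seg (Suc r) (Suc c) (e (Suc r))
      @ seg r (s r) c @ (r, c) # seg r (Suc c) (e r) @ Q) X'"
proof -
  have ps: "set ps = X" "sorted_wrt before ps"
    using assms(1) by (simp_all only: reads_def)
  have P: "set P = {p \<in> region. Suc r < fst p}" and Q: "set Q = {p \<in> region. fst p < r}"
    unfolding P_def Q_def set_filter ps by auto
  have sorted: "sorted_wrt before P" "sorted_wrt before Q"
    unfolding P_def Q_def by (simp_all only: sorted_wrt_filter ps)
  have in_seg: "(a, b) \<in> set (seg k x y) \<longleftrightarrow> a = k \<and> x \<le> b \<and> b < y" for a b k x y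
    by auto
  have "reads (P @ seg (Suc r) (s (Suc r)) c @ (Suc r, c) # seg (Suc r) (Suc c) (e (Suc r))
      @ seg r (s r) c @ seg r (Suc c) (e r) @ Q) X"
    unfolding reads_def
  proof
    show "set (P @ seg (Suc r) (s (Suc r)) c @ (Suc r, c) # seg (Suc r) (Suc c) (e (Suc r))
      @ seg r (s r) c @ seg r (Suc c) (e r) @ Q) = X"
    proof (rule set_eqI, unfold split_paired_all)
      fix a b
      consider "a < r" | "a = r" | "a = Suc r" | "Suc r < a"
        by linarith
      then show "(a, b) \<in> set (P @ seg (Suc r) (s (Suc r)) c @ (Suc r, c) # seg (Suc r) (Suc c) (e (Suc r))
          @ seg r (s r) c @ seg r (Suc c) (e r) @ Q) \<longleftrightarrow> (a, b) \<in> X"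
        using rows by cases (auto simp: P Q in_seg simp del: set_map)
    qed
  qed (use sorted in \<open>auto simp: sorted_wrt_append sorted_wrt_map before_def P Q\<close>)
  then show "ps = P @ seg (Suc r) (s (Suc r)) c @ (Suc r, c) # seg (Suc r) (Suc c) (e (Suc r))
      @ seg r (s r) c @ seg r (Suc c) (e r) @ Q"
    using reads_unique assms(1) by blast
  show "reads (P @ seg (Suc r) (s (Suc r)) c @ seg (Suc r) (Suc c) (e (Suc r))
      @ seg r (s r) c @ (r, c) # seg r (Suc c) (e r) @ Q) X'"
    unfolding reads_def
  proof
    show "set (P @ seg (Suc r) (s (Suc r)) c @ seg (Suc r) (Suc c) (e (Suc r))
      @ seg r (s r) c @ (r, c) # seg r (Suc c) (e r) @ Q) = X'"
    proof (rule set_eqI, unfold split_paired_all)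
      fix a b
      consider "a < r" | "a = r" | "a = Suc r" | "Suc r < a"
        by linarith
      then show "(a, b) \<in> set (P @ seg (Suc r) (s (Suc r)) c @ seg (Suc r) (Suc c) (e (Suc r))
          @ seg r (s r) c @ (r, c) # seg r (Suc c) (e r) @ Q) \<longleftrightarrow> (a, b) \<in> X'"
        using rows by cases (auto simp: P Q in_seg simp del: set_map)
    qed
  qed (use sorted in \<open>auto simp: sorted_wrt_append sorted_wrt_map before_def P Q\<close>)
qed

text \<open>If the upper row starts on the diagonal, then so do the rows below, and \<open>lettering_strict\<close> applied
  along the diagonal leaves very little room for boxes below the two rows: at most the diagonal box
  \<open>(r + 2, r + 2)\<close>, and this one only if the moving letter itself comes from the diagonal.\<close>

lemma corner:
  assumes straight: "s r = r" and q: "q \<in> region" "Suc r < fst q"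
  shows "c = Suc r" and "q = (Suc (Suc r), Suc (Suc r))"
    and "(Suc r, Suc (Suc r)) \<in> region"
    and "idx (G (Suc r, c)) < idx (G (Suc (Suc r), Suc (Suc r)))"
    and "\<not> precedes (G (Suc (Suc r), Suc (Suc r))) (G (Suc r, Suc (Suc r)))"
proof -
  let ?r1 = "Suc r" and ?r2 = "Suc (Suc r)" and ?r3 = "Suc (Suc (Suc r))"
  have start: "s k = k" if "r \<le> k" for k
    using straight_start[of r k] rows straight that by simp
  have diag: "(k, k) \<in> region" if "r \<le> k" "k \<le> fst p" "p \<in> region" for k p
    using that end_antimono[of k "fst p" "fst p"] start[of k] start[of "fst p"] rows
    by (cases p) auto
  have "(?r2, ?r2) \<in> region"
    using diag[of ?r2 q] q by simp
  then have s: "(?r2, ?r2) \<in> X" and d: "(?r1, ?r2) \<in> region"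
    using start[of ?r1] start[of ?r2] end_step[of ?r1] by auto
  have a: "(r, r) \<in> X" and c1: "(?r1, ?r1) \<in> region"
    using start[of r] start[of ?r1] rows d by auto
  show c: "c = ?r1"
  proof (rule ccontr)
    assume "c \<noteq> ?r1"
    then have c1X: "(?r1, ?r1) \<in> X" and m: "(r, ?r1) \<in> X" and dX: "(?r1, ?r2) \<in> X"
      using c1 d rows start[of r] by auto
    have "idx (G (r, r)) < idx (G (?r1, ?r1))"
      using standardD[OF std a m] standardD[OF std m c1X]
      by (intro lettering_strict[OF lett a m c1X]) (auto simp: before_def)
    moreover have "idx (G (?r1, ?r1)) < idx (G (?r2, ?r2))"
      using standardD[OF std c1X dX] standardD[OF std dX s]
      by (intro lettering_strict[OF lett c1X dX s]) (auto simp: before_def)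
    ultimately show False
      using lettering_letters[OF lett a] lettering_letters[OF lett c1X] lettering_letters[OF lett s]
      by auto
  qed
  have dX: "(?r1, ?r2) \<in> X" and yX: "(?r1, c) \<in> X"
    using d below by auto
  show "(?r1, ?r2) \<in> region"
    by (fact d)
  have xd: "F (?r1, c) < F (?r1, ?r2)"
    using standardD[OF std yX dX] c by simp
  have ds: "F (?r1, ?r2) < F (?r2, ?r2)"
    using standardD[OF std dX s] by simp
  show xs: "idx (G (?r1, c)) < idx (G (?r2, ?r2))"
    using xd ds c by (intro lettering_strict[OF lett yX dX s]) (auto simp: before_def)
  show "\<not> precedes (G (?r2, ?r2)) (G (?r1, ?r2))"
    using letteringD[OF lett s dX] ds by (simp add: before_def)
  have no: "(?r2, ?r3) \<notin> region"
  proof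
    assume *: "(?r2, ?r3) \<in> region"
    then have d2: "(?r1, ?r3) \<in> X" and s2: "(?r2, ?r3) \<in> X"
      using start[of ?r1] start[of ?r2] end_step[of ?r1] by auto
    have "idx (G (?r1, ?r2)) < idx (G (?r2, ?r3))"
      using standardD[OF std dX d2] standardD[OF std d2 s2]
      by (intro lettering_strict[OF lett dX d2 s2]) (auto simp: before_def)
    moreover have "idx (G (?r1, c)) < idx (G (?r1, ?r2))"
      using right_larger(4)[of ?r2] d c by simp
    ultimately show False
      using lettering_letters[OF lett dX] lettering_letters[OF lett yX] lettering_letters[OF lett s2]
      by auto
  qed
  have "fst q \<le> ?r2"
  proof (rule ccontr)
    assume "\<not> fst q \<le> ?r2"
    then have "(?r3, ?r3) \<in> region"
      using diag[of ?r3 q] q by simp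
    then show False
      using no start[of ?r2] end_step[of ?r2] by auto
  qed
  then have "fst q = ?r2"
    using q by simp
  then show "q = (?r2, ?r2)"
    using q no start[of ?r2] by (cases q) auto
qed

lemma columns:
  assumes "\<And>d. a \<le> d \<Longrightarrow> d < b \<Longrightarrow> (r, d) \<in> X \<and> (Suc r, d) \<in> X"
  shows "list_all2 (\<lambda>d b. \<not> precedes d b) (map G (seg (Suc r) a b)) (map G (seg r a b))"
  using assms column_not_precedes[OF std lett, of r _ "Suc r"]
  by (auto simp: list_all2_map1 list_all2_map2 list_all2_same)

lemma lower_row:
  assumes "s (Suc r) \<le> a" and "a \<le> c"
  shows "sorted_wrt precedes
    (map G (seg (Suc r) a c) @ G (Suc r, c) # map G (seg (Suc r) (Suc c) (e (Suc r))))"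
proof -
  have "[a..<e (Suc r)] = [a..<c] @ c # [Suc c..<e (Suc r)]"
    using assms rows upt_split[of a c "e (Suc r)"] upt_conv_Cons[of c "e (Suc r)"] by simp
  moreover have "sorted_wrt precedes (map (\<lambda>d. G (Suc r, d)) [a..<e (Suc r)])"
    using assms by (intro row_sorted[OF std lett]) auto
  ultimately show ?thesis
    by (simp add: comp_def)
qed

lemma upper_row:
  assumes "lettering X' F' G'"
  shows "sorted_wrt precedes
    (map G (seg r (s r) c) @ G (Suc r, c) # map G (seg r (Suc c) (e r)))"
proof -
  have "[s r..<e r] = [s r..<c] @ c # [Suc c..<e r]"
    using rows upt_split[of "s r" c "e r"] upt_conv_Cons[of c "e r"] by simp
  moreover have "sorted_wrt precedes (map (\<lambda>d. G' (r, d)) [s r..<e r])"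
    using rows by (intro row_sorted[OF std' assms]) auto
  moreover have "map (\<lambda>d. G' (r, d)) [a..<b] = map (\<lambda>d. G (r, d)) [a..<b]"
    if "b \<le> c \<or> c < a" for a b
    using that by auto
  ultimately show ?thesis
    by (simp add: comp_def del: fun_upd_apply) simp
qed

lemma walk_preserved:
  assumes ps: "reads ps X" and diag: "s r = r \<Longrightarrow> c = Suc r \<Longrightarrow> \<not> is_primed (G (Suc r, c))"
  obtains ps' where "reads ps' X'" and "wt (map G' ps') i = wt (map G ps) i"
    and "walk (map G' ps') (0, 0) = walk (map G ps) (0, 0)"
proof -
  define P Q where "P = filter (\<lambda>p. Suc r < fst p) ps" and "Q = filter (\<lambda>p. fst p < r) ps"
  define C A D B x where "C = map G (seg (Suc r) (s (Suc r)) c)" and "A = map G (seg r (s r) c)"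
    and "D = map G (seg (Suc r) (Suc c) (e (Suc r)))" and "B = map G (seg r (Suc c) (e r))"
    and "x = G (Suc r, c)"
  define ps' where "ps' = P @ seg (Suc r) (s (Suc r)) c @ seg (Suc r) (Suc c) (e (Suc r))
      @ seg r (s r) c @ (r, c) # seg r (Suc c) (e r) @ Q"
  have set_ps: "set ps = X" "sorted_wrt before ps"
    using ps by (simp_all only: reads_def)
  have setP: "set P = {p \<in> region. Suc r < fst p}"
    unfolding P_def set_filter set_ps by auto
  have sortP: "sorted_wrt before P"
    unfolding P_def by (simp only: sorted_wrt_filter set_ps)
  have ps': "reads ps' X'"
    using reads_X(2)[OF ps] by (simp only: ps'_def P_def Q_def)
  have w: "map G ps = map G P @ C @ x # D @ A @ B @ map G Q"
    using arg_cong[OF reads_X(1)[OF ps], of "map G"]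
    unfolding map_append list.map P_def[symmetric] Q_def[symmetric]
    by (simp only: C_def A_def D_def B_def x_def)
  have w': "map G' ps' = map G P @ C @ D @ A @ x # B @ map G Q"
  proof -
    have "(r, c) \<notin> set P" "(r, c) \<notin> set Q"
      by (auto simp: P_def Q_def)
    then show ?thesis
      by (auto simp: ps'_def C_def A_def D_def B_def x_def)
  qed
  have wt: "wt (map G' ps') i = wt (map G ps) i"
    unfolding w w' by (simp add: wt_Cons)
  have lett': "lettering X' F' G'"
    using lett' diag by blast
  have upper: "sorted_wrt precedes (A @ x # B)"
    using upper_row[OF lett'] by (simp only: A_def B_def x_def)
  have letters: "set (C @ A @ x # D @ B) \<subseteq> letters"
  proof -
    have "set (map G ps) \<subseteq> letters"
      using lett by (simp only: lettering_def set_map set_ps)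
    then show ?thesis
      unfolding w by simp
  qed
  have lenD: "length D \<le> length B"
    using rows by (simp add: D_def B_def)
  have "take (length D) B = map G (seg r (Suc c) (e (Suc r)))"
    using rows by (simp add: D_def B_def take_map)
  then have colsD: "list_all2 (\<lambda>d b. \<not> precedes d b) D (take (length D) B)"
    using columns[of "Suc c" "e (Suc r)"] rows by (simp add: D_def)
  have "walk (map G' ps') (0, 0) = walk (map G ps) (0, 0)"
  proof (cases "s (Suc r) \<le> s r")
    case True
    \<comment> \<open>Every entry of the upper row to the left of the empty box has a box below it.\<close>
    define C0 C1 where "C0 = map G (seg (Suc r) (s (Suc r)) (s r))"
      and "C1 = map G (seg (Suc r) (s r) c)"
    have C: "C = C0 @ C1"
      using True rows upt_split[of "s (Suc r)" "s r" c] by (simp add: C_def C0_def C1_def)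
    have "walk (C1 @ x # D @ A @ B) R = walk (C1 @ D @ A @ x # B) R" for R
    proof (rule walk_slide_up)
      show "sorted_wrt precedes (C1 @ x # D)"
        using lower_row[of "s r"] True rows by (simp only: C1_def x_def D_def)
      show "list_all2 (\<lambda>c a. \<not> precedes c a) C1 A"
        unfolding C1_def A_def using True rows by (intro columns) auto
    qed (use letters C upper lenD colsD in \<open>auto simp: C1_def A_def\<close>)
    then show ?thesis
      unfolding w w' C by simp
  next
    case False
    then have start: "s r = r" "s (Suc r) = Suc r"
      using start_step[of r] rows by auto
    \<comment> \<open>The upper row starts on the diagonal, and its first entry has no box below it.\<close>
    define a A1 where "a = G (r, r)" and "A1 = map G (seg r (Suc r) c)"
    have A: "A = a # A1"
      using start rows by (simp add: A_def a_def A1_def upt_conv_Cons)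
    have aX: "(r, r) \<in> X" and cX: "(Suc r, Suc r) \<in> X"
      using start rows by auto
    have ca: "\<not> precedes (G (Suc r, Suc r)) a"
      unfolding a_def by (intro iffD1[OF arg_cong[OF letteringD[OF lett cX aX], of Not]])
        (use standardD[OF std aX cX] in \<open>auto simp: before_def\<close>)
    show ?thesis
    proof (cases "P = []")
      case True
      have hdC: "hd (C @ [x]) = G (Suc r, Suc r)"
        using start rows by (cases "c = Suc r") (auto simp: C_def x_def upt_conv_Cons)
      have "walk (C @ x # D @ a # A1 @ B) (0, 0) = walk (C @ D @ a # A1 @ x # B) (0, 0)"
      proof (rule walk_slide_up_diagonal)
        show "sorted_wrt precedes (C @ x # D)"
          using lower_row[of "Suc r"] start rows by (simp add: C_def x_def D_def)
        show "list_all2 (\<lambda>c a. \<not> precedes c a) C A1"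
          unfolding C_def A1_def start using start rows by (intro columns) auto
      qed (use letters A upper lenD colsD start ca hdC in \<open>auto simp: C_def A1_def\<close>)
      then show ?thesis
        unfolding w w' A True by simp
    next
      case False
      then obtain q where "q \<in> set P"
        by (cases P) auto
      then have q: "q \<in> region" "Suc r < fst q"
        by (auto simp: setP)
      note cor = corner[OF start(1)]
      have c: "c = Suc r"
        using cor(1)[OF q] .
      let ?s = "(Suc (Suc r), Suc (Suc r))"
      have "p = ?s" if "p \<in> set P" for p
        using cor(2)[of p] that by (simp add: setP)
      then have "set P = {?s}"
        using \<open>q \<in> set P\<close> by blast
      then have "P = [?s]"
        using reads_unique[of P "{?s}" "[?s]"] sortP by (simp add: reads_def)
      have C: "C = []" and A1: "A1 = []"
        using c start by (simp_all add: C_def A1_def)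
      have D: "D \<noteq> []" "hd D = G (Suc r, Suc (Suc r))"
        using cor(3)[OF q] c by (auto simp: D_def upt_conv_Cons)
      have "walk (G ?s # x # D @ [a]) (0, 0) = walk (G ?s # D @ [a, x]) (0, 0)"
      proof (rule walk_slide_up_corner)
        have "?s \<in> X"
          using q cor(2)[OF q] by auto
        then show "set (a # G ?s # x # D) \<subseteq> letters"
          using letters A lettering_letters[OF lett, of ?s] by auto
        show "sorted_wrt precedes D"
          using lower_row[of c] rows by (simp add: D_def)
        show "idx x < idx (hd D)"
          using right_larger(4)[OF cor(3)[OF q]] c D by (simp add: x_def)
        show "idx x < idx (G ?s)" "\<not> precedes (G ?s) (hd D)"
          using cor(4,5)[OF q] D by (simp_all add: x_def)
        show "precedes a x"
          using upper A A1 by simp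
        show "\<not> precedes x a" "\<not> is_primed x"
          using ca diag start c by (simp_all add: x_def)
      qed (fact D(1))
      then show ?thesis
        unfolding w w' A \<open>P = [?s]\<close> C A1 by simp
    qed
  qed
  then show ?thesis
    using that ps' wt by blast
qed

end

text \<open>If the moving letter comes from the diagonal and the row above starts on the diagonal as well, then it
  is the first letter of its index, by \<open>corner\<close>, so that its prime can be chosen freely. After the move
  the diagonal letter of the upper row may come before it and have the same index. Therefore it is made
  unprimed in advance.\<close>

lemma (in skew_region) move_up:
  assumes std: "standard (region - {(r, c)}) F" and lett: "lettering (region - {(r, c)}) F G"
    and ps: "reads ps (region - {(r, c)})"
    and h: "(r, c) \<in> region" "(Suc r, c) \<in> region"
    and smaller: "(r, Suc c) \<in> region \<Longrightarrow> F (Suc r, c) < F (r, Suc c)"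
  obtains G' ps' where "reads ps' (region - {(Suc r, c)})"
    and "lettering (region - {(Suc r, c)}) (F((r, c) := F (Suc r, c))) G'"
    and "wt (map G' ps') i = wt (map G ps) i"
    and "walk (map G' ps') (0, 0) = walk (map G ps) (0, 0)"
proof -
  interpret slide_up i s e F G r c
    using assms by unfold_locales
  let ?y = "(Suc r, c)"
  define H where "H = (if s r = r \<and> c = Suc r then G(?y := Unprimed (idx (G ?y))) else G)"
  have idxH: "idx (H p) = idx (G p)" for p
    by (simp add: H_def)
  have "lettering X F H"
  proof (cases "s r = r \<and> c = Suc r")
    case True
    have first: "idx (G p) \<noteq> idx (G ?y)" if "p \<in> X" "before p ?y" for p
    proof -
      have "Suc r < fst p"
        using that True straight_start[of r "Suc r"] rows by (cases p) (auto simp: before_def)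
      then show ?thesis
        using corner(2,4)[of p] True that by fastforce
    qed
    have "precedes (H p) (H q) \<longleftrightarrow> precedes (G p) (G q)"
      if "p \<in> X" "q \<in> X" "before p q" for p q
      using first[of p] that by (auto simp: H_def precedes_def)
    moreover have "idx (H p) = i \<or> idx (H p) = i + 1" if "p \<in> X" for p
      using lettering_letters[OF lett that] idxH by simp
    then have "H ` X \<subseteq> letters"
      by blast
    ultimately show ?thesis
      using letteringD[OF lett] unfolding lettering_def by blast
  next
    case False
    then have "H = G"
      by (auto simp: H_def)
    then show ?thesis
      using lett by simp
  qed
  interpret H: slide_up i s e F H r c
    using assms \<open>lettering X F H\<close> by unfold_locales
  have diag: "\<not> is_primed (H ?y)" if "s r = r" "c = Suc r"
    using that by (simp add: H_def)
  obtain ps' where ps': "reads ps' X'" "wt (map H.G' ps') i = wt (map H ps) i"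
      "walk (map H.G' ps') (0, 0) = walk (map H ps) (0, 0)"
    using H.walk_preserved[OF ps diag] by blast
  have "walk (map H ps) (0, 0) = walk (map G ps) (0, 0)"
    using lettering_walk_unique[OF \<open>lettering X F H\<close> lett ps] idxH by blast
  moreover have "wt (map H ps) i = wt (map G ps) i"
    using idxH by (simp add: wt_def filter_map comp_def)
  ultimately show ?thesis
    using that[OF ps'(1) H.lett'] diag ps'(2,3) by simp
qed

section \<open>Slides and rectification of tableaux\<close>

definition part :: "nat list \<Rightarrow> nat \<Rightarrow> nat" where
  "part l r = (if 1 \<le> r \<and> r \<le> length l then l ! (r - 1) else 0)"

lemma in_diagram: "(r, c) \<in> diagram l \<longleftrightarrow> 1 \<le> r \<and> r \<le> c \<and> c < r + part l r"
  by (auto simp: diagram_def part_def)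

lemma part_decreasing:
  assumes "strict_partition l" and "1 \<le> r" and "0 < part l (Suc r)"
  shows "part l (Suc r) < part l r"
  using assms sorted_wrt_nth_less[of "(>)" l "r - 1" r]
  by (auto simp: strict_partition_def part_def split: if_splits)

lemma skew_region_diagrams:
  assumes "strict_partition l" and "strict_partition m"
  shows "skew_region (\<lambda>r. r + part m r) (\<lambda>r. r + part l r)"
proof
  fix r :: nat
  assume "1 \<le> r"
  then show "Suc r + part m (Suc r) \<le> r + part m r \<or> r + part m r = r \<and> Suc r + part m (Suc r) = Suc r"
    using part_decreasing[OF assms(2), of r] by (cases "0 < part m (Suc r)") auto
  assume "Suc r < Suc r + part l (Suc r)"
  then show "Suc r + part l (Suc r) \<le> r + part l r"
    using part_decreasing[OF assms(1) \<open>1 \<le> r\<close>] by auto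
qed auto

lemma diagram_difference:
  assumes "strict_partition l" and "strict_partition m"
  shows "skew_region.region (\<lambda>r. r + part m r) (\<lambda>r. r + part l r) = diagram l - diagram m"
proof -
  interpret skew_region 0 "\<lambda>r. r + part m r" "\<lambda>r. r + part l r"
    using skew_region_diagrams[OF assms] .
  show ?thesis
    by (auto simp: in_diagram)
qed

lemma reads_reading_boxes: "reads (reading_boxes T) (boxes T)"
proof -
  have rows: "sorted_wrt before (concat (map (\<lambda>r. map (Pair r) (cs r)) rs))"
    if "sorted_wrt (>) rs" "\<And>r. sorted_wrt (<) (cs r)" for cs :: "nat \<Rightarrow> nat list" and rs
    using that
  proof (induction rs)
    case (Cons r rs)
    have "sorted_wrt before (map (Pair r) (cs r))"
      unfolding sorted_wrt_map
      by (rule sorted_wrt_mono_rel[OF _ Cons.prems(2)]) (simp add: before_def)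
    moreover have "before (r, a) (r', b)" if "r' < r" for r' a b
      using that by (simp add: before_def)
    ultimately show ?case
      using Cons by (auto simp: sorted_wrt_append)
  qed simp
  have "sorted_wrt before (reading_boxes T)"
    unfolding reading_boxes_def
    by (intro sorted_wrt_filter rows) (auto simp: sorted_wrt_rev simp del: upt_Suc)
  moreover have "set (reading_boxes T) = boxes T"
  proof -
    have "(a, b) \<in> Pair r ` S \<longleftrightarrow> a = r \<and> b \<in> S" for a b r :: nat and S
      by auto
    then show ?thesis
      by (auto simp: reading_boxes_def boxes_def diagram_def simp del: upt_Suc)
  qed
  ultimately show ?thesis
    by (simp add: reads_def)
qed

lemma std_before_precedes:
  assumes "j < k"
  shows "std_before w j k \<longleftrightarrow> precedes (w ! j) (w ! k)"
    and "std_before w k j \<longleftrightarrow> \<not> precedes (w ! j) (w ! k)"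
  using assms by (cases "w ! j"; cases "w ! k";
    auto simp: std_before_def precedes_def less_letter_def)+

lemma standardization_less:
  assumes "j < length w" and "k < length w"
  shows "standardization w ! j < standardization w ! k \<longleftrightarrow> std_before w j k"
proof -
  define B where "B k = {j. j < length w \<and> std_before w j k}" for k
  have trans: "std_before w a b \<Longrightarrow> std_before w b c \<Longrightarrow> std_before w a c" for a b c
    by (auto simp: std_before_def split: if_splits)
  have irrefl: "\<not> std_before w a a" for a
    by (simp add: std_before_def)
  have less: "card (B a) < card (B b)" if "std_before w a b" "a < length w" for a b
  proof (rule psubset_card_mono)
    show "finite (B b)"
      by (simp add: B_def)
    have "B a \<subseteq> B b" "a \<in> B b" "a \<notin> B a"
      using that trans irrefl by (auto simp: B_def)
    then show "B a \<subset> B b"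
      by blast
  qed
  have "std_before w j k \<or> j = k \<or> std_before w k j"
    using std_before_precedes[of j k w] std_before_precedes[of k j w] by (meson nat_neq_iff)
  then have "card (B j) < card (B k) \<longleftrightarrow> std_before w j k"
    using less assms by (metis less_asym less_irrefl)
  then show ?thesis
    using assms by (simp add: standardization_def B_def)
qed

lemma ss_tableau_entry:
  assumes "ss_tableau T" and "p \<in> boxes T"
  shows "entry T p = Some (the (entry T p))"
proof -
  have "dom (entry T) = boxes T"
    using assms(1) by (simp add: ss_tableau_def skew_filling_def)
  then show ?thesis
    using assms(2) by (metis domD option.sel)
qed

lemma ss_tableau_row:
  assumes T: "ss_tableau T" and "(r, c) \<in> boxes T" and "(r, c') \<in> boxes T" and "c < c'"
  shows "precedes (the (entry T (r, c))) (the (entry T (r, c')))"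
proof -
  let ?a = "the (entry T (r, c))" and ?b = "the (entry T (r, c'))"
  have "\<forall>r c c' a b. c < c' \<and> entry T (r, c) = Some a \<and> entry T (r, c') = Some b \<longrightarrow>
      a \<le> b \<and> (a = b \<longrightarrow> \<not> is_primed a)"
    using T unfolding ss_tableau_def by (elim conjE)
  then have "?a \<le> ?b \<and> (?a = ?b \<longrightarrow> \<not> is_primed ?a)"
    using ss_tableau_entry[OF T] assms(2-) by metis
  then show ?thesis
    by (cases ?a; cases ?b) (auto simp: precedes_def less_eq_letter_def)
qed

lemma ss_tableau_column:
  assumes T: "ss_tableau T" and "(r, c) \<in> boxes T" and "(r', c) \<in> boxes T" and "r < r'"
  shows "\<not> precedes (the (entry T (r', c))) (the (entry T (r, c)))"
proof -
  let ?a = "the (entry T (r, c))" and ?b = "the (entry T (r', c))"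
  have "\<forall>r r' c a b. r < r' \<and> entry T (r, c) = Some a \<and> entry T (r', c) = Some b \<longrightarrow>
      a \<le> b \<and> (a = b \<longrightarrow> is_primed a)"
    using T unfolding ss_tableau_def by (elim conjE)
  then have "?a \<le> ?b \<and> (?a = ?b \<longrightarrow> is_primed ?a)"
    using ss_tableau_entry[OF T] assms(2-) by metis
  then show ?thesis
    by (cases ?a; cases ?b) (auto simp: precedes_def less_eq_letter_def)
qed

definition std_value :: "letter filling \<Rightarrow> nat \<times> nat \<Rightarrow> nat" where
  "std_value T p = the (entry (std T) p)"

lemma dom_entry_std: "dom (entry (std T)) = boxes T"
  using reads_reading_boxes[of T]
  by (simp add: std_def reads_def standardization_def reading_word_def)

lemma std_value_less:
  assumes "p \<in> boxes T" and "q \<in> boxes T" and "before p q"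
  shows "std_value T p < std_value T q \<longleftrightarrow> precedes (the (entry T p)) (the (entry T q))"
    and "std_value T q < std_value T p \<longleftrightarrow> \<not> precedes (the (entry T p)) (the (entry T q))"
proof -
  let ?ps = "reading_boxes T" and ?w = "reading_word T"
  have ps: "sorted_wrt before ?ps" "set ?ps = boxes T" "distinct ?ps"
    using reads_reading_boxes[of T] reads_distinct[OF reads_reading_boxes[of T]]
    by (simp_all add: reads_def)
  obtain j k where jk: "j < length ?ps" "k < length ?ps" "?ps ! j = p" "?ps ! k = q"
    using assms ps(2) by (metis in_set_conv_nth)
  have "j < k"
  proof (rule ccontr)
    assume "\<not> j < k"
    then have "k = j \<or> before q p"
      using sorted_wrt_nth_less[OF ps(1), of k j] jk by (cases "k < j") auto
    then show False
      using assms(3) before_asym jk by blast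
  qed
  have len: "length (standardization ?w) = length ?ps" "length ?w = length ?ps"
    by (simp_all add: standardization_def reading_word_def)
  have val: "std_value T (?ps ! m) = standardization ?w ! m" if "m < length ?ps" for m
    using map_of_zip_nth[OF len(1)[symmetric] ps(3), of m] that len by (simp add: std_value_def std_def)
  have letter: "?w ! m = the (entry T (?ps ! m))" if "m < length ?ps" for m
    using that by (simp add: reading_word_def)
  show "std_value T p < std_value T q \<longleftrightarrow> precedes (the (entry T p)) (the (entry T q))"
    using standardization_less[of j ?w k] std_before_precedes(1)[OF \<open>j < k\<close>, of ?w]
      val letter jk len by metis
  show "std_value T q < std_value T p \<longleftrightarrow> \<not> precedes (the (entry T p)) (the (entry T q))"
    using standardization_less[of k ?w j] std_before_precedes(2)[OF \<open>j < k\<close>, of ?w]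
      val letter jk len by metis
qed

text \<open>Two boxes weakly southeast of each other are compared by way of the box in the row of the first and
  the column of the second, which belongs to the skew shape.\<close>

lemma standard_std_value:
  assumes T: "ss_tableau T"
  shows "standard (boxes T) (std_value T)"
proof -
  have strict: "strict_partition (outer T)" "strict_partition (inner T)"
    using T by (simp_all add: ss_tableau_def skew_filling_def)
  interpret skew_region 0 "\<lambda>r. r + part (inner T) r" "\<lambda>r. r + part (outer T) r"
    using skew_region_diagrams[OF strict] .
  have region: "region = boxes T"
    unfolding boxes_def using diagram_difference[OF strict] .
  have neq: "std_value T p \<noteq> std_value T q" if "p \<in> boxes T" "q \<in> boxes T" "before p q" for p q
    using std_value_less[OF that] by linarith
  have "inj_on (std_value T) (boxes T)"
    using neq before_total by (metis inj_onI)
  moreover have "std_value T p < std_value T q"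
    if pq: "p \<in> boxes T" "q \<in> boxes T" "p \<noteq> q" "fst p \<le> fst q" "snd p \<le> snd q" for p q
  proof -
    obtain r c r' c' where [simp]: "p = (r, c)" "q = (r', c')"
      by fastforce
    have m: "(r, c') \<in> boxes T"
      using region_corner[of r c r' c'] pq region by simp
    have "c = c' \<or> std_value T (r, c) < std_value T (r, c')"
      using std_value_less(1)[of "(r, c)" T "(r, c')"] ss_tableau_row[OF T, of r c c'] pq m
      by (cases "c < c'") (auto simp: before_def)
    moreover have "r = r' \<or> std_value T (r, c') < std_value T (r', c')"
      using std_value_less(2)[of "(r', c')" T "(r, c')"] ss_tableau_column[OF T, of r c' r'] pq m
      by (cases "r < r'") (auto simp: before_def)
    ultimately show ?thesis
      using pq by auto
  qed
  ultimately show ?thesis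
    by (simp add: standard_def)
qed

context two_letter_walk
begin

lemma lettering_std_value:
  assumes "set (reading_word T) \<subseteq> letters"
  shows "lettering (boxes T) (std_value T) (\<lambda>p. the (entry T p))"
proof -
  have "(\<lambda>p. the (entry T p)) ` boxes T = set (reading_word T)"
    using reads_reading_boxes[of T] by (simp add: reading_word_def reads_def)
  then show ?thesis
    using assms std_value_less(1)[of _ T] by (simp add: lettering_def)
qed

end

lemma standard_cong:
  assumes "\<And>p. p \<in> X \<Longrightarrow> F p = F' p"
  shows "standard X F \<longleftrightarrow> standard X F'"
  using assms inj_on_cong[of X F F'] by (simp add: standard_def)

context skew_region
begin

lemma lettering_cong:
  assumes "\<And>p. p \<in> X \<Longrightarrow> F p = F' p"
  shows "lettering X F G \<longleftrightarrow> lettering X F' G"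
  using assms by (simp add: lettering_def)

text \<open>The invariant of a slide. The letters are not fixed by it, because a prime may have to be changed in
  the course of the slide, as in \<open>move_up\<close>.\<close>

definition slide_state ::
  "nat \<Rightarrow> nat \<times> nat \<Rightarrow> (nat \<times> nat \<Rightarrow> nat option) \<times> (nat \<times> nat) \<Rightarrow> bool" where
  "slide_state n P S \<longleftrightarrow> (case S of (f, h) \<Rightarrow>
     h \<in> region \<and> dom f = region - {h} \<and> standard (region - {h}) (the \<circ> f) \<and>
     (\<exists>G ps. reads ps (region - {h}) \<and> lettering (region - {h}) (the \<circ> f) G \<and>
        wt (map G ps) i = n \<and> walk (map G ps) (0, 0) = P))"

lemma slide_move_state:
  assumes "slide_move S S'" and "slide_state n P S"
  shows "slide_state n P S'"
  using assms
proof cases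
  case (right f r c a)
  let ?h = "(r, c)" and ?y = "(r, Suc c)"
  obtain G ps where state: "?h \<in> region" "dom f = region - {?h}" "standard (region - {?h}) (the \<circ> f)"
      "reads ps (region - {?h})" "lettering (region - {?h}) (the \<circ> f) G"
      "wt (map G ps) i = n" "walk (map G ps) (0, 0) = P"
    using assms(2) right by (auto simp: slide_state_def)
  have "?y \<in> dom f"
    using right(3) by auto
  then have y: "?y \<in> region"
    using state(2) by blast
  let ?f = "f(?h := Some a, ?y := None)" and ?F = "(the \<circ> f)(?h := (the \<circ> f) ?y)"
  have F: "(the \<circ> ?f) p = ?F p" if "p \<in> region - {?y}" for p
    using that right(3) by auto
  have "standard (region - {?y}) ?F"
  proof (rule standard_move[OF state(3,1) y])
    fix z assume z: "z \<in> region" "z = (r, c + 1) \<or> z = (r + 1, c)" "z \<noteq> ?y"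
    then have "z \<in> dom f"
      unfolding state(2) by auto
    then obtain b where "f z = Some b"
      by auto
    then show "(the \<circ> f) ?y < (the \<circ> f) z"
      using right(3,4) z by auto
  qed simp
  then have "standard (region - {?y}) (the \<circ> ?f)"
    using standard_cong[of "region - {?y}" "the \<circ> ?f" ?F] F by blast
  obtain G' ps' where *: "reads ps' (region - {?y})" "lettering (region - {?y}) ?F G'"
      "map G' ps' = map G ps"
    using move_right[OF state(5,4,1) y] by metis
  have "lettering (region - {?y}) (the \<circ> ?f) G'"
    using lettering_cong[of "region - {?y}" "the \<circ> ?f" ?F] F *(2) by blast
  moreover have "wt (map G' ps') i = n" "walk (map G' ps') (0, 0) = P"
    using * state(6,7) by simp_all
  ultimately have ex: "\<exists>G ps. reads ps (region - {?y}) \<and> lettering (region - {?y}) (the \<circ> ?f) G \<and>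
      wt (map G ps) i = n \<and> walk (map G ps) (0, 0) = P"
    using *(1) by blast
  have "dom ?f = region - {?y}"
    using state(1,2) by auto
  then show ?thesis
    using ex y \<open>standard (region - {?y}) (the \<circ> ?f)\<close> right(2)
    by (simp add: slide_state_def del: in_region fun_upd_apply)
next
  case (down f r c a)
  let ?h = "(r, c)" and ?y = "(Suc r, c)"
  obtain G ps where state: "?h \<in> region" "dom f = region - {?h}" "standard (region - {?h}) (the \<circ> f)"
      "reads ps (region - {?h})" "lettering (region - {?h}) (the \<circ> f) G"
      "wt (map G ps) i = n" "walk (map G ps) (0, 0) = P"
    using assms(2) down by (auto simp: slide_state_def)
  have "?y \<in> dom f"
    using down(3) by auto
  then have y: "?y \<in> region"
    using state(2) by blast
  let ?f = "f(?h := Some a, ?y := None)" and ?F = "(the \<circ> f)(?h := (the \<circ> f) ?y)"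
  have F: "(the \<circ> ?f) p = ?F p" if "p \<in> region - {?y}" for p
    using that down(3) by auto
  have smaller: "(the \<circ> f) ?y < (the \<circ> f) z"
    if z: "z \<in> region" "z = (r, c + 1) \<or> z = (r + 1, c)" "z \<noteq> ?y" for z
  proof -
    have "z \<in> dom f"
      unfolding state(2) using z by auto
    then obtain b where "f z = Some b"
      by auto
    then show ?thesis
      using down(3,4) z by auto
  qed
  have "standard (region - {?y}) ?F"
    using standard_move[OF state(3,1) y] smaller by simp
  then have "standard (region - {?y}) (the \<circ> ?f)"
    using standard_cong[of "region - {?y}" "the \<circ> ?f" ?F] F by blast
  obtain G' ps' where *: "reads ps' (region - {?y})" "lettering (region - {?y}) ?F G'"
      "wt (map G' ps') i = wt (map G ps) i" "walk (map G' ps') (0, 0) = walk (map G ps) (0, 0)"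
    using move_up[OF state(3,5,4,1) y] smaller[of "(r, Suc c)"] by (metis Suc_eq_plus1 Pair_inject n_not_Suc_n)
  have "lettering (region - {?y}) (the \<circ> ?f) G'"
    using lettering_cong[of "region - {?y}" "the \<circ> ?f" ?F] F *(2) by blast
  moreover have "wt (map G' ps') i = n" "walk (map G' ps') (0, 0) = P"
    using * state(6,7) by simp_all
  ultimately have ex: "\<exists>G ps. reads ps (region - {?y}) \<and> lettering (region - {?y}) (the \<circ> ?f) G \<and>
      wt (map G ps) i = n \<and> walk (map G ps) (0, 0) = P"
    using *(1) by blast
  have "dom ?f = region - {?y}"
    using state(1,2) by auto
  then show ?thesis
    using ex y \<open>standard (region - {?y}) (the \<circ> ?f)\<close> down(2)
    by (simp add: slide_state_def del: in_region fun_upd_apply)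
qed

end

context two_letter_walk
begin

text \<open>The letters carried along to the end of the slide need not be those of the tableau \<open>T'\<close>, but they have
  the same standardization and weight.\<close>

lemma inner_slide_walk:
  assumes slide: "inner_slide T T'" and letters: "set (reading_word T) \<subseteq> letters"
  shows "set (reading_word T') \<subseteq> letters"
    and "walk (reading_word T') (0, 0) = walk (reading_word T) (0, 0)"
proof -
  obtain b r c f where T: "ss_tableau T" "ss_tableau T'" "weight T' = weight T"
    and b: "b \<in> diagram (inner T)" "diagram (inner T') = diagram (inner T) - {b}"
    and moves: "slide_move\<^sup>*\<^sup>* (entry (std T), b) (f, (r, c))"
    and last: "entry (std T') = f"
    using slide unfolding inner_slide_def by blast
  have wt: "wt (reading_word T') n = wt (reading_word T) n" for n
    using T(3) by (metis weight_def)
  show letters': "set (reading_word T') \<subseteq> letters"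
  proof
    fix a assume a: "a \<in> set (reading_word T')"
    then have "wt (reading_word T') (idx a) \<noteq> 0"
      by (auto simp: wt_def filter_empty_conv)
    then have "wt (reading_word T) (idx a) \<noteq> 0"
      by (simp only: wt not_False_eq_True)
    then have "\<exists>a' \<in> set (reading_word T). idx a' = idx a"
      by (auto simp: wt_def filter_empty_conv)
    then show "a \<in> letters"
      using letters by auto
  qed
  have strict: "strict_partition (outer T)" "strict_partition (inner T')"
    and sub: "diagram (inner T) \<subseteq> diagram (outer T)"
    using T by (simp_all add: ss_tableau_def skew_filling_def)
  interpret skew_region i "\<lambda>r. r + part (inner T') r" "\<lambda>r. r + part (outer T) r"
    using skew_region_diagrams[OF strict] .
  have region: "region = diagram (outer T) - diagram (inner T')"
    using diagram_difference[OF strict] .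
  have start: "b \<in> region" "boxes T = region - {b}"
    using b sub by (auto simp: region boxes_def simp del: in_region)
  define G where "G T p = the (entry T p)" for T :: "letter filling" and p
  have word: "map (G T) (reading_boxes T) = reading_word T" for T
    by (simp add: G_def reading_word_def)
  have val: "the \<circ> entry (std T) = std_value T" for T
    by (auto simp: std_value_def)
  have lett: "lettering (boxes T) (std_value T) (G T)"
    if "set (reading_word T) \<subseteq> letters" for T
    using lettering_std_value[OF that] by (simp add: G_def[abs_def])
  have "slide_state (wt (reading_word T) i) (walk (reading_word T) (0, 0)) (entry (std T), b)"
    unfolding slide_state_def prod.case val
    using start standard_std_value[OF T(1)] lett[OF letters] reads_reading_boxes[of T] word[of T]
      dom_entry_std[of T] by (metis (no_types, lifting))
  with moves have "slide_state (wt (reading_word T) i) (walk (reading_word T) (0, 0)) (f, (r, c))"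
    by (induction rule: rtranclp_induct) (auto intro: slide_move_state)
  then obtain H ps where "dom f = region - {(r, c)}" "reads ps (region - {(r, c)})"
      "lettering (region - {(r, c)}) (the \<circ> f) H" "wt (map H ps) i = wt (reading_word T) i"
      "walk (map H ps) (0, 0) = walk (reading_word T) (0, 0)"
    by (auto simp: slide_state_def)
  then have H: "reads ps (boxes T')" "lettering (boxes T') (std_value T') H"
      "wt (map H ps) i = wt (reading_word T) i"
      "walk (map H ps) (0, 0) = walk (reading_word T) (0, 0)"
    using last val[of T'] dom_entry_std[of T'] by simp_all
  have ps: "map (G T') ps = reading_word T'"
    using reads_unique[OF H(1) reads_reading_boxes] word by simp
  have inj: "inj_on (std_value T') (boxes T')"
    using standard_std_value[OF T(2)] by (simp add: standard_def)
  have "idx (G T' p) = idx (H p)" if "p \<in> boxes T'" for p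
    using lettering_idx_unique[OF lett[OF letters'] H(2,1) inj _ that] H(3) ps wt by simp
  then show "walk (reading_word T') (0, 0) = walk (reading_word T) (0, 0)"
    using lettering_walk_unique[OF lett[OF letters'] H(2,1)] H(4) ps by simp
qed

lemma rectification_walk:
  assumes "inner_slide\<^sup>*\<^sup>* T R" and "set (reading_word T) \<subseteq> letters"
  shows "set (reading_word R) \<subseteq> letters \<and> weight R = weight T \<and>
    walk (reading_word R) (0, 0) = walk (reading_word T) (0, 0)"
  using assms
proof (induction rule: rtranclp_induct)
  case (step R R')
  have "weight R' = weight R"
    using step.hyps(2) unfolding inner_slide_def by blast
  then show ?case
    using step inner_slide_walk[OF step.hyps(2)] by simp
qed simp

end

section \<open>Straight shapes\<close>

context two_letter_walk
begin

text \<open>The list \<open>filter ((<) 0) [n, k]\<close> is the strict partition with parts \<open>n\<close> and \<open>k\<close>, of which \<open>k\<close> or both may be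
  zero. There are at most two rows, because the index increases along the diagonal.\<close>

lemma straight_tableau_shape:
  assumes T: "ss_tableau T" and straight: "inner T = []" and letters: "set (reading_word T) \<subseteq> letters"
  obtains n k where "outer T = filter ((<) 0) [n, k]" and "length (reading_word T) = n + k"
    and "spread (walk (reading_word T) (0, 0)) + k = n"
proof -
  define g where "g p = the (entry T p)" for p
  have strict: "strict_partition (outer T)"
    using T by (simp add: ss_tableau_def skew_filling_def)
  have boxes: "(r, c) \<in> boxes T \<longleftrightarrow> 1 \<le> r \<and> r \<le> c \<and> c < r + part (outer T) r" for r c
    using straight by (auto simp: boxes_def in_diagram part_def[of "[]"])
  have word: "reading_word T = map g (reading_boxes T)"
    by (simp add: reading_word_def g_def)
  have row: "precedes (g (r, c)) (g (r, c'))"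
    if "(r, c) \<in> boxes T" "(r, c') \<in> boxes T" "c < c'" for r c c'
    using ss_tableau_row[OF T that] by (simp add: g_def)
  have col: "\<not> precedes (g (r', c)) (g (r, c))"
    if "(r, c) \<in> boxes T" "(r', c) \<in> boxes T" "r < r'" for r r' c
    using ss_tableau_column[OF T that] by (simp add: g_def)
  have g: "idx (g p) = i \<or> idx (g p) = i + 1" if "p \<in> boxes T" for p
  proof -
    have "g p \<in> set (reading_word T)"
      using that reads_reading_boxes[of T] by (simp add: word reads_def)
    then show ?thesis
      using letters by auto
  qed
  have diag: "idx (g (r, r)) < idx (g (Suc r, Suc r))" if "(r, r) \<in> boxes T" "(Suc r, Suc r) \<in> boxes T" for r
  proof -
    have "(r, Suc r) \<in> boxes T"
      using that part_decreasing[OF strict, of r] by (auto simp: boxes)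
    then show ?thesis
      using row[of r r "Suc r"] col[of r "Suc r" "Suc r"] that
      by (intro precedes_not_precedes_less[of _ "g (r, Suc r)"]) auto
  qed
  have pos: "0 < outer T ! j" if "j < length (outer T)" for j
    using strict that by (simp add: strict_partition_def)
  have "length (outer T) \<le> 2"
  proof (rule ccontr)
    assume "\<not> length (outer T) \<le> 2"
    then have "0 < length (outer T)" "1 < length (outer T)" "2 < length (outer T)"
      by linarith+
    then have "(1, 1) \<in> boxes T" "(2, 2) \<in> boxes T" "(3, 3) \<in> boxes T"
      using pos[of 0] pos[of 1] pos[of 2] by (simp_all add: boxes part_def del: length_greater_0_conv)
    moreover from this have "idx (g (1, 1)) < idx (g (2, 2))" "idx (g (2, 2)) < idx (g (3, 3))"
      using diag[of 1] diag[of 2] by (simp_all add: numeral_2_eq_2 numeral_3_eq_3)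
    ultimately show False
      using g[of "(1, 1)"] g[of "(2, 2)"] g[of "(3, 3)"] by auto
  qed
  then consider "outer T = []" | n where "outer T = [n]" | n k where "outer T = [n, k]"
    by (cases "outer T"; cases "tl (outer T)"; cases "tl (tl (outer T))") auto
  then show ?thesis
  proof cases
    case 1
    then have "reading_word T = []"
      by (simp add: word reading_boxes_def)
    then show ?thesis
      using 1 that[of 0 0] by (simp add: spread_def)
  next
    case (2 n)
    have "reading_word T = map g (seg 1 1 (Suc n))"
      using 2 straight by (simp add: word reading_boxes_def diagram_def comp_def)
    moreover have "sorted_wrt precedes (map g (seg 1 1 (Suc n)))"
      unfolding sorted_wrt_map
      by (rule sorted_wrt_mono_rel[OF _ sorted_wrt_upt], rule row)
        (use 2 in \<open>auto simp: boxes part_def\<close>)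
    ultimately show ?thesis
      using spread_walk_row[of "reading_word T" 0] letters 2 that[of n 0] pos[of 0] by simp
  next
    case (3 n k)
    define u w where "u = map g (seg 2 2 (2 + k))" and "w = map g (seg 1 1 (Suc n))"
    have uw: "reading_word T = u @ w"
      using 3 straight by (simp add: word reading_boxes_def diagram_def u_def w_def numeral_2_eq_2)
    have nk: "k < n" "0 < k"
      using 3 strict by (auto simp: strict_partition_def)
    have b1: "(Suc 0, c) \<in> boxes T \<longleftrightarrow> 1 \<le> c \<and> c < Suc n" for c
      using 3 by (auto simp: boxes part_def)
    have b2: "(2, c) \<in> boxes T \<longleftrightarrow> 2 \<le> c \<and> c < 2 + k" for c
      using 3 by (auto simp: boxes part_def)
    have corner: "idx (g (Suc 0, Suc 0)) = i \<and> idx (g (2, 2)) = i + 1"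
      using diag[of "Suc 0"] g[of "(Suc 0, Suc 0)"] g[of "(2, 2)"] b1[of 1] b2[of 2] nk
      by (auto simp: numeral_2_eq_2)
    have "spread (walk (u @ w) (0, 0)) + length u = length w"
    proof (rule spread_walk_straight)
      show "set (u @ w) \<subseteq> letters"
        using letters uw by simp
      show "sorted_wrt precedes w"
        unfolding w_def sorted_wrt_map
        by (rule sorted_wrt_mono_rel[OF _ sorted_wrt_upt], rule row) (auto simp: b1)
      show "\<forall>b \<in> set u. idx b = i + 1"
      proof
        fix b assume "b \<in> set u"
        then obtain c where c: "b = g (2, c)" "2 \<le> c" "c < 2 + k"
          by (auto simp: u_def)
        then have "c = 2 \<or> precedes (g (2, 2)) (g (2, c))"
          using row[of 2 2 c] b2[of 2] b2[of c] nk by (cases "c = 2") simp_all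
        moreover have "idx (g (2, c)) = i \<or> idx (g (2, c)) = i + 1"
          using g[of "(2, c)"] b2 c by simp
        ultimately show "idx b = i + 1"
          using c(1) corner unfolding precedes_def by (metis less_irrefl less_SucI Suc_eq_plus1 not_less_eq)
      qed
      show "idx (hd w) = i"
        using corner nk by (simp add: w_def upt_conv_Cons del: upt_Suc)
      show "\<not> precedes (u ! j) (w ! Suc j)" if "j < length u" for j
        using col[of "Suc 0" "2 + j" 2] that nk by (simp add: u_def w_def b1 b2 del: upt_Suc)
    qed (use nk in \<open>simp_all add: u_def w_def del: upt_Suc\<close>)
    moreover have "length u = k" "length w = n"
      by (simp_all add: u_def w_def del: upt_Suc)
    ultimately show ?thesis
      using that[of n k] 3 nk uw by simp
  qed
qed

lemma walk_step_idx:
  assumes "a \<in> letters" and "b \<in> letters" and "walk_step i a P = walk_step i b P"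
  shows "idx a = idx b"
  using assms by (cases a; cases b; cases P) (auto split: if_splits)

lemma lattice_walk_determines:
  assumes "set v \<subseteq> letters" and "set w \<subseteq> letters" and "lattice_walk i v = lattice_walk i w"
  shows "map idx v = map idx w" and "walk v (0, 0) = walk w (0, 0)"
proof -
  have len: "length v = length w"
    using arg_cong[OF assms(3), of length] by (simp add: lattice_walk_def)
  have P: "walk (take k v) (0, 0) = walk (take k w) (0, 0)" if "k \<le> length w" for k
  proof -
    have "lattice_walk i v ! k = lattice_walk i w ! k"
      using assms(3) by simp
    then show ?thesis
      using that len by (simp add: lattice_walk_def walk_def del: upt_Suc)
  qed
  show "walk v (0, 0) = walk w (0, 0)"
    using P[of "length w"] len by simp
  show "map idx v = map idx w"
  proof (rule nth_equalityI)
    fix k assume k: "k < length (map idx v)"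
    have "walk_step i (v ! k) (walk (take k v) (0, 0)) = walk_step i (w ! k) (walk (take k w) (0, 0))"
      using P[of "Suc k"] k len by (simp add: take_Suc_conv_app_nth)
    then show "map idx v ! k = map idx w ! k"
      using walk_step_idx[of "v ! k" "w ! k"] P[of k] k len assms(1,2) by (simp add: subset_eq)
  qed (simp add: len)
qed

end

theorem theorem1p5:
  fixes i :: nat and v w :: "letter list" and Q R :: "letter filling"
  assumes "1 \<le> i"
    and "is_word v" and "set v \<subseteq> {Primed i, Unprimed i, Primed (i + 1), Unprimed (i + 1)}"
    and "is_word w" and "set w \<subseteq> {Primed i, Unprimed i, Primed (i + 1), Unprimed (i + 1)}"
    and "lattice_walk i v = lattice_walk i w"
    and "is_rect v Q" and "is_rect w R"
  shows "shape Q = shape R \<and> weight Q = weight R"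
proof -
  interpret two_letter_walk i .
  have letters: "set v \<subseteq> letters" "set w \<subseteq> letters"
    using assms(3,5) by auto
  obtain S T where S: "reading_word S = v" "inner_slide\<^sup>*\<^sup>* S Q" "inner Q = []"
    and T: "reading_word T = w" "inner_slide\<^sup>*\<^sup>* T R" "inner R = []"
    and "ss_tableau S" "ss_tableau T"
    using assms(7,8) unfolding is_rect_def rectifies_to_def by blast
  have tableau: "ss_tableau U'" if "inner_slide\<^sup>*\<^sup>* U U'" "ss_tableau U" for U U'
    using that by (induction rule: rtranclp_induct) (auto simp: inner_slide_def)
  have ss: "ss_tableau Q" "ss_tableau R"
    using tableau S(2) T(2) \<open>ss_tableau S\<close> \<open>ss_tableau T\<close> by blast+
  have Q: "set (reading_word Q) \<subseteq> letters" "weight Q = weight S"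
    "walk (reading_word Q) (0, 0) = walk v (0, 0)"
    using rectification_walk[OF S(2)] letters(1) S(1) by simp_all
  have R: "set (reading_word R) \<subseteq> letters" "weight R = weight T"
    "walk (reading_word R) (0, 0) = walk w (0, 0)"
    using rectification_walk[OF T(2)] letters(2) T(1) by simp_all
  note same = lattice_walk_determines[OF letters assms(6)]
  have wt_idx: "wt u n = length (filter (\<lambda>m. m = n) (map idx u))" for u n
    by (simp add: wt_def filter_map comp_def)
  have weight: "weight Q = weight R"
    using Q(2) R(2) same(1) S(1) T(1) by (simp add: weight_def fun_eq_iff wt_idx)
  have length: "length u = wt u i + wt u (i + 1)" if "set u \<subseteq> letters" for u
    using that by (induction u) (auto simp: wt_def)
  have len: "length (reading_word Q) = length (reading_word R)"
    using length[OF Q(1)] length[OF R(1)] weight by (simp add: weight_def fun_eq_iff)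
  obtain n k where nk: "outer Q = filter ((<) 0) [n, k]" "length (reading_word Q) = n + k"
      "spread (walk (reading_word Q) (0, 0)) + k = n"
    using straight_tableau_shape[OF ss(1) S(3) Q(1)] .
  obtain n' k' where nk': "outer R = filter ((<) 0) [n', k']" "length (reading_word R) = n' + k'"
      "spread (walk (reading_word R) (0, 0)) + k' = n'"
    using straight_tableau_shape[OF ss(2) T(3) R(1)] .
  have "n = n' \<and> k = k'"
    using nk(2,3) nk'(2,3) len Q(3) R(3) same(2) by simp
  then show ?thesis
    using nk(1) nk'(1) S(3) T(3) weight by (simp add: shape_def)
qed

end
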